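(* Let $d\ge2$ be an integer. If $A\in\{\widetilde{\mathbf{A}}_{d-1}^{(+)},\widetilde{\mathbf{B}}_d^{(+)},\widetilde{\mathbf{C}}_d^{(+)},\widetilde{\mathbf{D}}_d^{(+)}\}$, then $I_A$ is generated by quadratic binomials in $C_A^{\mathrm{sf}}$.
   Context: Let $\mathbf{e}_1,\dots,\mathbf{e}_d$ be the unit coordinate vectors of $\mathbb{R}^d$ and $\mathbf{0}$ the origin. Define $\mathbf{A}_{d-1}^{(+)}=\{\mathbf{0}\}\cup\{\mathbf{e}_i-\mathbf{e}_j : 1\le i<j\le d\}$, $\mathbf{B}_d^{(+)}=\mathbf{A}_{d-1}^{(+)}\cup\{\mathbf{e}_1,\dots,\mathbf{e}_d\}\cup\{\mathbf{e}_i+\mathbf{e}_j : 1\le i<j\le d\}$, $\mathbf{C}_d^{(+)}=\mathbf{A}_{d-1}^{(+)}\cup\{\mathbf{e}_i+\mathbf{e}_j : 1\le i\le j\le d\}$, $\mathbf{D}_d^{(+)}=\mathbf{A}_{d-1}^{(+)}\cup\{\mathbf{e}_i+\mathbf{e}_j : 1\le i<j\le d\}$. For each such set $\Phi^{(+)}$, $\widetilde{\Phi}^{(+)}$ is the integer matrix with $d+1$ rows whose columns are the vectors $(\alpha,1)^\top$ for $\alpha\in\Phi^{(+)}$ (each once), i.e. the matrix with columns $\Phi^{(+)}$ with an additional last row of ones. Let $K$ be a field. For an integer matrix $A$ with $m$ rows and columns $\mathbf{a}_1,\dots,\mathbf{a}_n$, the toric ideal $I_A$ is the kernel of the $K$-algebra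 map $K[X]=K[x_1,\dots,x_n]\to K[t_1^{\pm1},\dots,t_m^{\pm1}]$, $x_j\mapsto T^{\mathbf{a}_j}=t_1^{a_{1j}}\cdots t_m^{a_{mj}}$. A binomial is a difference $u-v$ of two distinct monomials; it is quadratic if both monomials have degree 2. The support of a monomial $u$ is $\mathrm{supp}(u)=\{x_i : x_i \mid u\}$, and $\mathrm{supp}(u-v)=\mathrm{supp}(u)\cup\mathrm{supp}(v)$. An irreducible binomial $f\in I_A$ is a circuit of $I_A$ if there is no binomial $g\in I_A$ with $\mathrm{supp}(g)\subsetneq\mathrm{supp}(f)$. $C_A$ denotes the set of circuits of $I_A$, and $C_A^{\mathrm{sf}}$ is the set of circuits $u-v\in C_A$ such that at least one of $u,v$ is squarefree. The ideal generated by the empty set is the zero ideal. *)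

theory Defs
  imports "Jordan_Normal_Form.Matrix" "HOL-Algebra.Ring_Divisibility" "HOL-Library.Poly_Mapping"
begin

section \<open>Positive root configurations and their matrices\<close>

text \<open>
  Coordinates are numbered from \<open>0\<close> to \<open>d - 1\<close>, so \<open>unit_vec d i\<close> is the mathematical
  $e_{i+1}$.  All four configurations live in dimension \<open>d\<close>; \<open>pos_A d\<close> is the one usually
  denoted by $A_{d-1}^{(+)}$.
\<close>

definition pos_A :: "nat \<Rightarrow> int vec set" where
  "pos_A d = {0\<^sub>v d} \<union> {unit_vec d i - unit_vec d j | i j. i < j \<and> j < d}"

definition pos_B :: "nat \<Rightarrow> int vec set" where
  "pos_B d = pos_A d \<union> {unit_vec d i | i. i < d}
     \<union> {unit_vec d i + unit_vec d j | i j. i < j \<and> j < d}"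

definition pos_C :: "nat \<Rightarrow> int vec set" where
  "pos_C d = pos_A d \<union> {unit_vec d i + unit_vec d j | i j. i \<le> j \<and> j < d}"

definition pos_D :: "nat \<Rightarrow> int vec set" where
  "pos_D d = pos_A d \<union> {unit_vec d i + unit_vec d j | i j. i < j \<and> j < d}"

text \<open>
  \<open>is_tilde d \<Phi> A\<close>: the columns of \<open>A\<close> are the vectors of \<open>\<Phi>\<close>, each occurring once and
  extended by a last entry \<open>1\<close>.  The order of the columns is left open.
\<close>

definition is_tilde :: "nat \<Rightarrow> int vec set \<Rightarrow> int mat \<Rightarrow> bool" where
  "is_tilde d \<Phi> A \<longleftrightarrow> dim_row A = d + 1 \<and> distinct (cols A) \<and>
     set (cols A) = (\<lambda>\<alpha>. \<alpha> @\<^sub>v vec 1 (\<lambda>_. 1)) ` \<Phi>"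


section \<open>Polynomial and Laurent polynomial rings\<close>

text \<open>
  A polynomial is a finitely supported map from exponent vectors to coefficients.  The types
  allow infinitely many variables; the carriers below cut them down to the variables
  numbered \<open>0, \<dots>, n - 1\<close>.
\<close>

type_synonym 'k mpoly = "(nat \<Rightarrow>\<^sub>0 nat) \<Rightarrow>\<^sub>0 'k"
type_synonym 'k laurent = "(nat \<Rightarrow>\<^sub>0 int) \<Rightarrow>\<^sub>0 'k"

definition mpoly_ring :: "nat \<Rightarrow> 'k::field mpoly ring" where
  "mpoly_ring n = \<lparr>carrier = {p. \<forall>u \<in> Poly_Mapping.keys p. Poly_Mapping.keys u \<subseteq> {..<n}},
     mult = (*), one = 1, zero = 0, add = (+)\<rparr>"

definition laurent_ring :: "nat \<Rightarrow> 'k::field laurent ring" where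
  "laurent_ring m = \<lparr>carrier = {p. \<forall>u \<in> Poly_Mapping.keys p. Poly_Mapping.keys u \<subseteq> {..<m}},
     mult = (*), one = 1, zero = 0, add = (+)\<rparr>"


section \<open>Toric ideals\<close>

definition column_power :: "int mat \<Rightarrow> nat \<Rightarrow> 'k::field laurent" where
  "column_power A j =
     Poly_Mapping.single (\<Sum>i<dim_row A. Poly_Mapping.single i (A $$ (i, j))) 1"

text \<open>
  The \<open>K\<close>-algebra map $x_j \mapsto T^{a_j}$, written as substitution into each term; the
  factor \<open>Poly_Mapping.single 0 c\<close> is the constant \<open>c\<close>.
\<close>

definition toric_map :: "int mat \<Rightarrow> 'k::field mpoly \<Rightarrow> 'k laurent" where
  "toric_map A p = (\<Sum>u \<in> Poly_Mapping.keys p.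
     Poly_Mapping.single 0 (Poly_Mapping.lookup p u) *
       (\<Prod>j \<in> Poly_Mapping.keys u. column_power A j ^ Poly_Mapping.lookup u j))"

definition toric_ideal :: "int mat \<Rightarrow> 'k::field mpoly set" where
  "toric_ideal A = a_kernel (mpoly_ring (dim_col A)) (laurent_ring (dim_row A)) (toric_map A)"


section \<open>Binomials and circuits\<close>

text \<open>Monomials are given by their exponent vectors.\<close>

abbreviation monomial :: "(nat \<Rightarrow>\<^sub>0 nat) \<Rightarrow> 'k::field mpoly" where
  "monomial u \<equiv> Poly_Mapping.single u 1"

definition is_binomial :: "'k::field mpoly \<Rightarrow> bool" where
  "is_binomial f \<longleftrightarrow> (\<exists>u v. u \<noteq> v \<and> f = monomial u - monomial v)"

definition mon_degree :: "(nat \<Rightarrow>\<^sub>0 nat) \<Rightarrow> nat" where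
  "mon_degree u = (\<Sum>j \<in> Poly_Mapping.keys u. Poly_Mapping.lookup u j)"

definition is_quadratic_binomial :: "'k::field mpoly \<Rightarrow> bool" where
  "is_quadratic_binomial f \<longleftrightarrow>
     (\<exists>u v. u \<noteq> v \<and> f = monomial u - monomial v \<and> mon_degree u = 2 \<and> mon_degree v = 2)"

text \<open>
  The support consists of the indices of the occurring variables.  It is defined for every
  polynomial; on binomials it is the union of the two monomial supports, as shown next.
\<close>

definition supp :: "'k::field mpoly \<Rightarrow> nat set" where
  "supp f = (\<Union>u \<in> Poly_Mapping.keys f. Poly_Mapping.keys u)"

lemma keys_binomial:
  assumes "u \<noteq> v"
  shows "Poly_Mapping.keys (monomial u - monomial v :: 'k::field mpoly) = {u, v}"
  using assms by (auto simp: in_keys_iff lookup_minus lookup_single when_def split: if_splits)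

lemma supp_binomial:
  assumes "u \<noteq> v"
  shows "supp (monomial u - monomial v :: 'k::field mpoly) =
    Poly_Mapping.keys u \<union> Poly_Mapping.keys v"
  using keys_binomial[OF assms, where 'k = 'k] by (simp add: supp_def)

definition circuits :: "int mat \<Rightarrow> 'k::field mpoly set" where
  "circuits A = {f \<in> toric_ideal A. is_binomial f \<and>
     ring_irreducible\<^bsub>mpoly_ring (dim_col A)\<^esub> f \<and>
     \<not> (\<exists>g :: 'k mpoly. g \<in> toric_ideal A \<and> is_binomial g \<and> supp g \<subset> supp f)}"

definition squarefree_mon :: "(nat \<Rightarrow>\<^sub>0 nat) \<Rightarrow> bool" where
  "squarefree_mon u \<longleftrightarrow> (\<forall>j. Poly_Mapping.lookup u j \<le> 1)"

definition circuits_sf :: "int mat \<Rightarrow> 'k::field mpoly set" where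
  "circuits_sf A = {f \<in> circuits A.
     \<exists>u v. u \<noteq> v \<and> f = monomial u - monomial v \<and> (squarefree_mon u \<or> squarefree_mon v)}"


section \<open>The rings and the toric map are what they should be\<close>

lemma keys_times_vars:
  fixes p q :: "('v \<Rightarrow>\<^sub>0 'e::cancel_comm_monoid_add) \<Rightarrow>\<^sub>0 'k::field"
  assumes "\<forall>u \<in> Poly_Mapping.keys p. Poly_Mapping.keys u \<subseteq> V"
    and "\<forall>u \<in> Poly_Mapping.keys q. Poly_Mapping.keys u \<subseteq> V"
  shows "\<forall>u \<in> Poly_Mapping.keys (p * q). Poly_Mapping.keys u \<subseteq> V"
proof
  fix u assume "u \<in> Poly_Mapping.keys (p * q)"
  then obtain a b where "u = a + b" "a \<in> Poly_Mapping.keys p" "b \<in> Poly_Mapping.keys q"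
    using keys_mult[of p q] by blast
  then show "Poly_Mapping.keys u \<subseteq> V"
    using assms Poly_Mapping.keys_add[of a b] by blast
qed

lemma cring_poly_mapping:
  fixes V :: "'v set"
  shows "cring \<lparr>carrier = {p :: ('v \<Rightarrow>\<^sub>0 'e::cancel_comm_monoid_add) \<Rightarrow>\<^sub>0 'k::field.
      \<forall>u \<in> Poly_Mapping.keys p. Poly_Mapping.keys u \<subseteq> V},
     mult = (*), one = 1, zero = 0, add = (+)\<rparr>" (is "cring ?R")
proof (rule cringI)
  show "abelian_group ?R"
  proof (rule abelian_groupI)
    fix x y assume "x \<in> carrier ?R" "y \<in> carrier ?R"
    then show "x \<oplus>\<^bsub>?R\<^esub> y \<in> carrier ?R"
      using Poly_Mapping.keys_add[of x y] by auto
  next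
    fix x assume "x \<in> carrier ?R"
    then show "\<exists>y\<in>carrier ?R. y \<oplus>\<^bsub>?R\<^esub> x = \<zero>\<^bsub>?R\<^esub>"
      by (intro bexI[of _ "- x"]) auto
  qed (auto simp: algebra_simps)
  show "comm_monoid ?R"
  proof (rule comm_monoidI)
    fix x y assume "x \<in> carrier ?R" "y \<in> carrier ?R"
    then show "x \<otimes>\<^bsub>?R\<^esub> y \<in> carrier ?R"
      using keys_times_vars[of x V y] by simp
  qed (auto simp: algebra_simps)
qed (auto simp: algebra_simps)

lemma cring_mpoly_ring: "cring (mpoly_ring n)"
  unfolding mpoly_ring_def by (rule cring_poly_mapping)

lemma cring_laurent_ring: "cring (laurent_ring m)"
  unfolding laurent_ring_def by (rule cring_poly_mapping)

lemma toric_map_var: "toric_map A (monomial (Poly_Mapping.single j 1)) = column_power A j"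
  by (simp add: toric_map_def flip: single_one)

lemma column_power_carrier: "column_power A j \<in> carrier (laurent_ring (dim_row A))"
proof -
  have "Poly_Mapping.keys (\<Sum>i<dim_row A. Poly_Mapping.single i (A $$ (i, j))) \<subseteq> {..<dim_row A}"
    using Poly_Mapping.keys_sum[of "\<lambda>i. Poly_Mapping.single i (A $$ (i, j))" "{..<dim_row A}"]
    by (fastforce split: if_splits)
  then show ?thesis
    by (simp add: column_power_def laurent_ring_def)
qed

definition toric_term :: "int mat \<Rightarrow> (nat \<Rightarrow>\<^sub>0 nat) \<Rightarrow> 'k::field \<Rightarrow> 'k laurent" where
  "toric_term A u c = Poly_Mapping.single 0 c *
     (\<Prod>j \<in> Poly_Mapping.keys u. column_power A j ^ Poly_Mapping.lookup u j)"

lemma toric_term_zero: "toric_term A u 0 = 0"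
  by (simp add: toric_term_def)

lemma toric_term_add: "toric_term A u (c + c') = toric_term A u c + toric_term A u c'"
  by (simp add: toric_term_def single_add distrib_right)

lemma toric_term_mult:
  "toric_term A (u + v) (c * c') = toric_term A u c * toric_term A v (c' :: 'k::field)"
proof -
  let ?g = "column_power A :: nat \<Rightarrow> 'k laurent"
  let ?J = "Poly_Mapping.keys u \<union> Poly_Mapping.keys v"
  have *: "(\<Prod>j \<in> Poly_Mapping.keys w. ?g j ^ Poly_Mapping.lookup w j) =
      (\<Prod>j \<in> ?J. ?g j ^ Poly_Mapping.lookup w j)" if "Poly_Mapping.keys w \<subseteq> ?J" for w
    by (rule prod.mono_neutral_left) (use that in \<open>auto simp: in_keys_iff\<close>)
  have "(\<Prod>j \<in> Poly_Mapping.keys (u + v). ?g j ^ Poly_Mapping.lookup (u + v) j) =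
      (\<Prod>j \<in> ?J. ?g j ^ Poly_Mapping.lookup u j) * (\<Prod>j \<in> ?J. ?g j ^ Poly_Mapping.lookup v j)"
    by (subst *[OF Poly_Mapping.keys_add]) (simp add: lookup_add power_add prod.distrib)
  moreover have "Poly_Mapping.single 0 (c * c') =
      (Poly_Mapping.single 0 c * Poly_Mapping.single 0 c' :: 'k laurent)"
    by (simp add: mult_single)
  ultimately show ?thesis
    using *[of u] *[of v] by (simp add: toric_term_def mult_ac)
qed

lemma toric_map_superset:
  assumes "finite U" "Poly_Mapping.keys p \<subseteq> U"
  shows "toric_map A p = (\<Sum>u \<in> U. toric_term A u (Poly_Mapping.lookup p u))"
  unfolding toric_map_def toric_term_def[symmetric]
  by (rule sum.mono_neutral_left) (use assms in \<open>auto simp: in_keys_iff toric_term_zero\<close>)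

lemma toric_map_add: "toric_map A (p + q) = toric_map A p + toric_map A q"
proof -
  let ?U = "Poly_Mapping.keys p \<union> Poly_Mapping.keys q"
  have "toric_map A (p + q) = (\<Sum>u \<in> ?U. toric_term A u (Poly_Mapping.lookup (p + q) u))"
    by (rule toric_map_superset) (auto dest: subsetD[OF Poly_Mapping.keys_add])
  also have "\<dots> = toric_map A p + toric_map A q"
    by (simp add: toric_map_superset[of ?U] lookup_add toric_term_add sum.distrib)
  finally show ?thesis .
qed

lemma toric_map_single: "toric_map A (Poly_Mapping.single u c) = toric_term A u c"
  by (subst toric_map_superset[of "{u}"]) auto

lemma toric_map_sum: "toric_map A (\<Sum>i \<in> I. h i) = (\<Sum>i \<in> I. toric_map A (h i))"
  by (induction I rule: infinite_finite_induct) (simp_all add: toric_map_add, simp_all add: toric_map_def)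

lemma mpoly_as_sum:
  "p = (\<Sum>u \<in> Poly_Mapping.keys p. Poly_Mapping.single u (Poly_Mapping.lookup p u))"
  by (rule poly_mapping_eqI)
    (auto simp: lookup_sum lookup_single when_def in_keys_iff sum.delta')

lemma toric_map_mult: "toric_map A (p * q) = toric_map A p * toric_map A q"
proof -
  have "p * q = (\<Sum>u \<in> Poly_Mapping.keys p. \<Sum>v \<in> Poly_Mapping.keys q.
      Poly_Mapping.single (u + v) (Poly_Mapping.lookup p u * Poly_Mapping.lookup q v))"
    by (subst mpoly_as_sum[of p], subst mpoly_as_sum[of q])
      (simp add: sum_product mult_single)
  then show ?thesis
    by (simp add: toric_map_sum toric_map_single toric_term_mult sum_product
        toric_map_superset[of "Poly_Mapping.keys p" p] toric_map_superset[of "Poly_Mapping.keys q" q])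
qed

lemma toric_map_const:
  "toric_map A (Poly_Mapping.single 0 c) = Poly_Mapping.single 0 c"
  by (simp add: toric_map_single toric_term_def)

lemma toric_map_ring_hom:
  "(toric_map A :: 'k::field mpoly \<Rightarrow> _) \<in> ring_hom (mpoly_ring n) (laurent_ring (dim_row A))"
proof (rule ring_hom_memI)
  interpret L: cring "laurent_ring (dim_row A) :: 'k laurent ring" by (rule cring_laurent_ring)
  have ops: "x \<otimes>\<^bsub>laurent_ring (dim_row A)\<^esub> y = x * y" "x \<oplus>\<^bsub>laurent_ring (dim_row A)\<^esub> y = x + y"
    "\<one>\<^bsub>laurent_ring (dim_row A)\<^esub> = 1" "\<zero>\<^bsub>laurent_ring (dim_row A)\<^esub> = 0"
    for x y :: "'k laurent"
    by (simp_all add: laurent_ring_def)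
  note closed = L.m_closed[unfolded ops] L.one_closed[unfolded ops]
    L.a_closed[unfolded ops] L.zero_closed[unfolded ops]
  have pow: "x ^ k \<in> carrier (laurent_ring (dim_row A))"
    if "x \<in> carrier (laurent_ring (dim_row A))" for x :: "'k laurent" and k
    by (induction k) (use that closed in auto)
  have prods: "(\<Prod>j \<in> J. h j) \<in> carrier (laurent_ring (dim_row A))"
    if "\<And>j. h j \<in> carrier (laurent_ring (dim_row A))" for h :: "nat \<Rightarrow> 'k laurent" and J
    by (induction J rule: infinite_finite_induct)
      (use that closed in auto)
  have sums: "(\<Sum>j \<in> J. h j) \<in> carrier (laurent_ring (dim_row A))"
    if "\<And>j. h j \<in> carrier (laurent_ring (dim_row A))"
    for h :: "(nat \<Rightarrow>\<^sub>0 nat) \<Rightarrow> 'k laurent" and J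
    by (induction J rule: infinite_finite_induct)
      (use that closed in auto)
  have const: "Poly_Mapping.single 0 c \<in> carrier (laurent_ring (dim_row A))" for c :: 'k
    by (simp add: laurent_ring_def)
  fix p :: "'k mpoly"
  show "toric_map A p \<in> carrier (laurent_ring (dim_row A))"
    unfolding toric_map_def
    by (intro sums closed(1) const prods pow column_power_carrier)
next
  show "toric_map A \<one>\<^bsub>mpoly_ring n\<^esub> = \<one>\<^bsub>laurent_ring (dim_row A)\<^esub>"
    using toric_map_const[of A 1] by (simp add: mpoly_ring_def laurent_ring_def)
qed (simp_all add: mpoly_ring_def laurent_ring_def toric_map_add toric_map_mult)

end

theory Submission
  imports Defs
begin

text \<open>
  The toric ideal is spanned by binomials, so it is generated by quadrics as soon as any two
  multisets of roots with the same size and sum are connected by moves that replace \<open>{a, b}\<close>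
  by \<open>{c, d}\<close> with \<open>a + b = c + d\<close>.  By induction on the size it suffices to move both
  multisets so that they share an element.  If both can reach the element \<open>0\<close>, this is clear.
  If \<open>N\<close> cannot, then either \<open>N\<close> is coherent (no coordinate occurs with both signs),
  or it contains a pair with sum \<open>2 e i\<close>; in both cases \<open>N\<close> lies on or next to a face of the root
  polytope, given by a linear functional, so that every other multiset of the fiber does so too.
  A multiset of this kind can be moved to contain an edge chosen canonically from the sum alone.
  Finally, a quadratic binomial of the ideal fails to be a circuit only if four distinct
  collinear points occur, which root configurations do not contain.
\<close>

section \<open>Quadratic moves on multisets\<close>

text \<open>The root \<open>0\<close> drives the connectivity argument: a pair whose sum is a root
  can be replaced by that root together with \<open>0\<close>, so a multiset that cannot reach
  \<open>0\<close> contains no such pair. This would force coherence outright if every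
  \<open>2 e i\<close> were a root. It is one only in type C; in types B and D the pair
  \<open>e i - e j\<close>, \<open>e i + e j\<close> cancels a coordinate without merging, and this
  obstacle is why two kinds of zero-free multisets occur. In the coherent case the functional is
  read off from the signs of the sum. It is at most 2 on all roots; in type B one element
  \<open>e i\<close> may fall one unit short of 2, which is still less than the two units that an
  element \<open>0\<close> would cost. The canonical elements are singled out by extremality in the
  sum (a least index with a negative entry, a largest entry). Both multisets of a fiber have the
  same sum, hence the same target.\<close>

definition quadratic_move ::
    "'v::comm_monoid_add set \<Rightarrow> 'v multiset \<Rightarrow> 'v multiset \<Rightarrow> bool" where
  "quadratic_move V M N \<longleftrightarrow> (\<exists>a b c d X. a \<in> V \<and> b \<in> V \<and> c \<in> V \<and> d \<in> V \<and> a + b = c + d \<and>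
     M = {#a, b#} + X \<and> N = {#c, d#} + X)"

abbreviation conn :: "'v::comm_monoid_add set \<Rightarrow> 'v multiset \<Rightarrow> 'v multiset \<Rightarrow> bool" where
  "conn V \<equiv> (quadratic_move V)\<^sup>*\<^sup>*"

lemma conn_swap:
  assumes "{#a, b#} \<subseteq># M" "a \<in> V" "b \<in> V" "c \<in> V" "d \<in> V" "a + b = c + d"
  shows "conn V M (M - {#a, b#} + {#c, d#})"
proof -
  have "M = {#a, b#} + (M - {#a, b#})"
    using assms(1) by (simp only: subset_mset.add_diff_inverse)
  moreover have "M - {#a, b#} + {#c, d#} = {#c, d#} + (M - {#a, b#})"
    by (rule add.commute)
  ultimately have "quadratic_move V M (M - {#a, b#} + {#c, d#})"
    unfolding quadratic_move_def using assms(2-) by blast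
  then show ?thesis by blast
qed

lemma conn_sym: "conn V M N \<Longrightarrow> conn V N M"
proof (induction rule: rtranclp_induct)
  case (step M' N')
  have "quadratic_move V N' M'"
    using step(2) unfolding quadratic_move_def by metis
  then show ?case using step(3) by (rule converse_rtranclp_into_rtranclp)
qed simp

lemma quadratic_move_invariant:
  assumes "quadratic_move V M N"
  shows "size N = size M" "sum_mset N = sum_mset M" "set_mset M \<subseteq> V \<longleftrightarrow> set_mset N \<subseteq> V"
  using assms by (auto simp: quadratic_move_def add.assoc[symmetric])

lemma conn_size: "conn V M N \<Longrightarrow> size N = size M"
  by (induction rule: rtranclp_induct) (auto dest: quadratic_move_invariant)

lemma conn_sum: "conn V M N \<Longrightarrow> sum_mset N = sum_mset M"
  by (induction rule: rtranclp_induct) (auto dest: quadratic_move_invariant)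

lemma conn_subset: "conn V M N \<Longrightarrow> set_mset M \<subseteq> V \<longleftrightarrow> set_mset N \<subseteq> V"
  by (induction rule: rtranclp_induct) (auto dest!: quadratic_move_invariant(3))

lemma quadratic_move_add: "quadratic_move V M N \<Longrightarrow> quadratic_move V (M + X) (N + X)"
  unfolding quadratic_move_def by (metis add.assoc)

lemma conn_add: "conn V M N \<Longrightarrow> conn V (M + X) (N + X)"
  by (induction rule: rtranclp_induct) (auto intro: rtranclp.rtrancl_into_rtrancl quadratic_move_add)

text \<open>Two monomials have the same image under the toric map exactly in this situation: the
  upper rows of the matrix record the sum, the row of ones records the size.\<close>

definition same_fiber :: "'v::comm_monoid_add set \<Rightarrow> 'v multiset \<Rightarrow> 'v multiset \<Rightarrow> bool" where
  "same_fiber V M N \<longleftrightarrow>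
     set_mset M \<subseteq> V \<and> set_mset N \<subseteq> V \<and> size M = size N \<and> sum_mset M = sum_mset N"

definition share :: "'v::comm_monoid_add set \<Rightarrow> 'v multiset \<Rightarrow> 'v multiset \<Rightarrow> bool" where
  "share V M N \<longleftrightarrow> (\<exists>M' N' x. conn V M M' \<and> conn V N N' \<and> x \<in># M' \<and> x \<in># N')"

lemma shareI: "conn V M M' \<Longrightarrow> conn V N N' \<Longrightarrow> x \<in># M' \<Longrightarrow> x \<in># N' \<Longrightarrow> share V M N"
  by (auto simp: share_def)

lemma share_sym: "share V M N \<Longrightarrow> share V N M"
  by (auto simp: share_def)

lemma same_fiber_sym: "same_fiber V M N \<Longrightarrow> same_fiber V N M"
  by (auto simp: same_fiber_def)

lemma same_fiber_conn: "same_fiber V M N \<Longrightarrow> conn V M M' \<Longrightarrow> same_fiber V M' N"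
  using conn_size[of V M M'] conn_sum[of V M M'] conn_subset[of V M M']
  by (auto simp: same_fiber_def)

text \<open>A shared element can be cancelled, so a minimal pair of unconnected multisets shares none.\<close>

lemma conn_if_share:
  fixes V :: "'v::cancel_comm_monoid_add set"
  assumes share: "\<And>M N. same_fiber V M N \<Longrightarrow> M \<noteq> {#} \<Longrightarrow> share V M N"
    and "same_fiber V M N"
  shows "conn V M N"
  using assms(2)
proof (induction "size M" arbitrary: M N rule: less_induct)
  case less
  show ?case
  proof (cases "M = {#}")
    case True
    then show ?thesis using less(2) by (simp add: same_fiber_def)
  next
    case False
    obtain M' N' x where *: "conn V M M'" "conn V N N'" "x \<in># M'" "x \<in># N'"
      using share[OF less(2) False] by (auto simp: share_def)
    have fib: "same_fiber V M' N'"
      using less(2) *(1,2) by (meson same_fiber_conn same_fiber_sym)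
    obtain P Q where PQ: "M' = add_mset x P" "N' = add_mset x Q"
      using *(3,4) by (meson mset_add)
    have "same_fiber V P Q" using fib by (auto simp: same_fiber_def PQ)
    moreover have "size P < size M" using conn_size[OF *(1)] PQ by simp
    ultimately have "conn V P Q" using less(1) by blast
    from conn_add[OF this, of "{#x#}"] have "conn V M' N'" by (simp add: PQ)
    then show ?thesis using *(1,2) conn_sym by (meson rtranclp_trans)
  qed
qed

lemma additive_sum_mset:
  fixes f :: "'v::comm_monoid_add \<Rightarrow> int"
  assumes "f 0 = 0" "\<And>x y. f (x + y) = f x + f y"
  shows "f (sum_mset M) = (\<Sum>x\<in>#M. f x)"
  by (induction M) (simp_all add: assms)

lemma sum_mset_eq_imp_eq:
  fixes f :: "'v \<Rightarrow> int"
  assumes "\<And>x. x \<in># M \<Longrightarrow> f x \<le> g x" "(\<Sum>x\<in>#M. f x) = (\<Sum>x\<in>#M. g x)" "x \<in># M"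
  shows "f x = g x"
  using assms
proof (induction M)
  case (add y M)
  have "(\<Sum>x\<in>#M. f x) \<le> (\<Sum>x\<in>#M. g x)" using add.prems(1) by (intro sum_mset_mono) auto
  moreover have "f y \<le> g y" using add.prems(1) by simp
  ultimately have "f y = g y" "(\<Sum>x\<in>#M. f x) = (\<Sum>x\<in>#M. g x)"
    using add.prems(2) by auto
  then show ?case using add by auto
qed simp

text \<open>A functional bounded by \<open>c\<close> on \<open>V\<close> has the value
  \<open>c * size\<close> on a sum only if every element attains \<open>c\<close>, and size and sum
  are constant on a fiber.\<close>

lemma face_transfer:
  fixes f :: "'v::comm_monoid_add \<Rightarrow> int"
  assumes "f 0 = 0" "\<And>x y. f (x + y) = f x + f y"
    and "same_fiber V M N" "\<And>x. x \<in> V \<Longrightarrow> f x \<le> c" "\<And>x. x \<in># N \<Longrightarrow> f x = c" "x \<in># M"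
  shows "f x = c"
proof -
  have "(\<Sum>x\<in>#M. f x) = (\<Sum>x\<in>#N. f x)"
    using assms(3) additive_sum_mset[of f, OF assms(1,2)] by (metis same_fiber_def)
  also have "\<dots> = (\<Sum>x\<in>#N. c)" using assms(5) by (metis (no_types, lifting) image_mset_cong)
  also have "\<dots> = (\<Sum>x\<in>#M. c)" using assms(3) by (simp add: same_fiber_def)
  finally show ?thesis
    using assms(3,4,6) by (intro sum_mset_eq_imp_eq[of M f "\<lambda>_. c" x]) (auto simp: same_fiber_def)
qed

section \<open>Fibers of the root configurations\<close>

abbreviation e :: "nat \<Rightarrow> nat \<Rightarrow>\<^sub>0 int" where
  "e i \<equiv> Poly_Mapping.single i 1"

text \<open>The three flags encode the types: none for A, \<open>pairs\<close> for D,
  \<open>pairs\<close> and \<open>singles\<close> for B, \<open>pairs\<close> and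
  \<open>doubles\<close> for C.\<close>

definition roots :: "bool \<Rightarrow> bool \<Rightarrow> bool \<Rightarrow> nat \<Rightarrow> (nat \<Rightarrow>\<^sub>0 int) set" where
  "roots pairs singles doubles d = {0} \<union> {e i - e j | i j. i < j \<and> j < d}
     \<union> {e i + e j | i j. pairs \<and> i < j \<and> j < d}
     \<union> {e i | i. singles \<and> i < d}
     \<union> {e i + e i | i. doubles \<and> i < d}"

lemma lookup_e: "Poly_Mapping.lookup (e i) k = (if k = i then 1 else 0)"
  by (simp add: lookup_single when_def)

text \<open>Two different members always form a submultiset, whereas a repeated one would need
  multiplicity two.\<close>

lemma conn_swap_distinct:
  assumes "a \<in># M" "b \<in># M" "a \<noteq> b" "set_mset M \<subseteq> V" "c \<in> V" "d \<in> V" "a + b = c + d"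
  obtains M' where "conn V M M'" "c \<in># M'" "d \<in># M'"
proof -
  have "{#a, b#} \<subseteq># M" using assms(1-3) by (simp add: insert_subset_eq_iff in_diff_count)
  then show ?thesis using assms by (intro that[OF conn_swap[of a b M V c d]]) auto
qed

lemma lookup_sum_mset:
  "Poly_Mapping.lookup (sum_mset M :: 'a \<Rightarrow>\<^sub>0 int) k = (\<Sum>x\<in>#M. Poly_Mapping.lookup x k)"
  by (rule additive_sum_mset) (simp_all add: lookup_add)

lemma sum_mset_posD:
  assumes "(0::int) < (\<Sum>x\<in>#M. f x)"
  shows "\<exists>x\<in>#M. 0 < f x"
proof (rule ccontr)
  assume "\<not> ?thesis"
  then have "\<forall>x\<in>#M. f x \<le> 0" by auto
  then have "(\<Sum>x\<in>#M. f x) \<le> 0" by (induction M) auto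
  with assms show False by simp
qed

lemma sum_mset_negD:
  assumes "(\<Sum>x\<in>#M. f x) < (0::int)"
  shows "\<exists>x\<in>#M. f x < 0"
proof (rule ccontr)
  assume "\<not> ?thesis"
  then have "\<forall>x\<in>#M. 0 \<le> f x" by auto
  then have "0 \<le> (\<Sum>x\<in>#M. f x)" by (induction M) auto
  with assms show False by simp
qed

lemma sum_mset_pos:
  fixes f :: "'a \<Rightarrow> int"
  assumes "\<And>x. x \<in># M \<Longrightarrow> 0 \<le> f x" "y \<in># M" "0 < f y"
  shows "0 < (\<Sum>x\<in>#M. f x)"
proof -
  obtain X where X: "M = add_mset y X" using assms(2) by (meson mset_add)
  have "\<forall>x\<in>#X. 0 \<le> f x" using assms(1) X by auto
  then have "0 \<le> (\<Sum>x\<in>#X. f x)" by (induction X) auto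
  then show ?thesis using assms(3) X by simp
qed

lemma sum_mset_neg:
  fixes f :: "'a \<Rightarrow> int"
  assumes "\<And>x. x \<in># M \<Longrightarrow> f x \<le> 0" "y \<in># M" "f y < 0"
  shows "(\<Sum>x\<in>#M. f x) < 0"
proof -
  have "0 < (\<Sum>x\<in>#M. - f x)" using assms by (intro sum_mset_pos[of M "\<lambda>x. - f x" y]) auto
  also have "(\<Sum>x\<in>#M. - f x) = - (\<Sum>x\<in>#M. f x)" by (induction M) auto
  finally show ?thesis by simp
qed

lemma obtain_least:
  fixes P :: "nat \<Rightarrow> bool"
  assumes "\<exists>n. P n"
  obtains m where "P m" "\<And>j. P j \<Longrightarrow> m \<le> j"
  using that[OF LeastI_ex[OF assms]] Least_le[of P] by blast

lemma obtain_greatest: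
  fixes f :: "'a \<Rightarrow> int"
  assumes "finite A" "A \<noteq> {}"
  obtains h where "h \<in> A" "\<And>a. a \<in> A \<Longrightarrow> f a \<le> f h"
proof -
  have "Max (f ` A) \<in> f ` A" using assms by simp
  then obtain h where "h \<in> A" "f h = Max (f ` A)" by (metis imageE)
  then show ?thesis using that[of h] assms by simp
qed

text \<open>Types A to D at once. Excluding \<open>singles\<close> together with
  \<open>doubles\<close> has the effect that, whenever \<open>e i\<close> is a root, two copies of
  it have a sum that is not a root.\<close>

locale root_config =
  fixes d :: nat and pairs singles doubles :: bool
  assumes singles_pairs: "singles \<Longrightarrow> pairs" and doubles_pairs: "doubles \<Longrightarrow> pairs"
    and singles_doubles: "\<not> (singles \<and> doubles)"
begin

abbreviation "V \<equiv> roots pairs singles doubles d"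

lemma zero_root: "0 \<in> V" by (simp add: roots_def)

lemma neg_root: "i < j \<Longrightarrow> j < d \<Longrightarrow> e i - e j \<in> V"
  unfolding roots_def by blast

lemma single_root: "singles \<Longrightarrow> i < d \<Longrightarrow> e i \<in> V"
  unfolding roots_def by blast

lemma pos_root: "pairs \<Longrightarrow> i < d \<Longrightarrow> j < d \<Longrightarrow> i \<noteq> j \<or> doubles \<Longrightarrow> e i + e j \<in> V"
proof (induction i j rule: linorder_wlog)
  case (le i j)
  then consider "pairs \<and> i < j \<and> j < d" | "i = j" "doubles" "i < d" by fastforce
  then show ?case unfolding roots_def by cases blast+
next
  case (sym i j)
  then show ?case by (simp add: add.commute)
qed

lemma root_cases:
  assumes "x \<in> V"
  obtains "x = 0" | i j where "i < j" "j < d" "x = e i - e j"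
  | i j where "pairs" "i < d" "j < d" "i \<noteq> j \<or> doubles" "x = e i + e j"
  | i where "singles" "i < d" "x = e i"
proof -
  consider "x = 0" | "\<exists>i j. i < j \<and> j < d \<and> x = e i - e j"
    | "\<exists>i j. pairs \<and> i < j \<and> j < d \<and> x = e i + e j"
    | "\<exists>i. singles \<and> i < d \<and> x = e i" | "\<exists>i. doubles \<and> i < d \<and> x = e i + e i"
    using assms unfolding roots_def by blast
  then show ?thesis
  proof cases
    case 3
    then show ?thesis using that(3) by (metis less_imp_neq less_trans)
  next
    case 5
    then show ?thesis using that(3) doubles_pairs by blast
  qed (use that(1,2,4) in blast)+
qed

lemma root_lookup_pos:
  assumes "x \<in> V" "0 < Poly_Mapping.lookup x h"
  obtains l where "h < l" "l < d" "x = e h - e l"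
  | y where "pairs" "h < d" "y < d" "h \<noteq> y \<or> doubles" "x = e h + e y"
  | "singles" "h < d" "x = e h"
  using assms(1)
proof (cases rule: root_cases)
  case (3 i j)
  then show ?thesis using assms(2) that(2)[of i] that(2)[of j]
    by (auto simp: lookup_add lookup_e add.commute split: if_splits)
qed (use assms(2) that in \<open>auto simp: lookup_minus lookup_e split: if_splits\<close>)

lemma root_lookup_neg:
  assumes "x \<in> V" "Poly_Mapping.lookup x l < 0"
  obtains k where "k < l" "l < d" "x = e k - e l"
  using assms(1)
  by (cases rule: root_cases) (use assms(2) that in \<open>auto simp: lookup_minus lookup_add lookup_e split: if_splits\<close>)

section \<open>Faces of the root polytope cut out by a height functional\<close>

definition height :: "nat \<Rightarrow> nat set \<Rightarrow> (nat \<Rightarrow>\<^sub>0 int) \<Rightarrow> int" where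
  "height i L x = Poly_Mapping.lookup x i - (\<Sum>l\<in>L. Poly_Mapping.lookup x l)"

text \<open>Without doubles and for \<open>L\<close> below \<open>i\<close>, the roots of maximal
  height. An edge \<open>e k - e l\<close> of height 1 with \<open>l < i\<close> runs from a source
  \<open>k\<close> outside \<open>L\<close> to a sink \<open>l\<close> in \<open>L\<close>; all
  other roots of the face have entry 1 at \<open>i\<close>.\<close>

definition face :: "nat \<Rightarrow> nat set \<Rightarrow> (nat \<Rightarrow>\<^sub>0 int) set" where
  "face i L = {x \<in> V. height i L x = 1}"

lemma height_simps:
  "height i L 0 = 0"
  "height i L (x + y) = height i L x + height i L y"
  "height i L (x - y) = height i L x - height i L y"
  by (simp_all add: height_def lookup_add lookup_minus sum.distrib sum_subtractf)

lemma height_e: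
  assumes "L \<subseteq> {..<i}"
  shows "height i L (e a) = (if a = i then 1 else if a \<in> L then - 1 else 0)"
proof -
  have "finite L" using assms by (rule finite_subset) simp
  then show ?thesis using assms by (auto simp: height_def lookup_e)
qed

text \<open>The gain from an entry 1 at \<open>i\<close> and the gain from a negative entry in
  \<open>L\<close> exclude each other: \<open>e i - e l\<close> requires \<open>i < l\<close>, but
  \<open>L\<close> lies below \<open>i\<close>. The root \<open>2 e i\<close> would have height 2,
  so doubles are excluded.\<close>

lemma face_bound:
  assumes "\<not> doubles" "L \<subseteq> {..<i}" "x \<in> V"
  shows "height i L x \<le> 1"
  using assms(3)
  by (cases rule: root_cases)
    (use assms(1,2) in \<open>auto simp: height_simps height_e\<close>)

lemma face_cases:
  assumes "\<not> doubles" "L \<subseteq> {..<i}" "x \<in> face i L"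
  obtains k l where "k < l" "l < i" "l < d" "l \<in> L" "k \<notin> L" "x = e k - e l"
  | j where "i < j" "j < d" "x = e i - e j"
  | k where "pairs" "i < d" "k < d" "k \<noteq> i" "k \<notin> L" "x = e i + e k"
  | "singles" "i < d" "x = e i"
proof -
  have x: "x \<in> V" "height i L x = 1"
    using assms(3) by (auto simp: face_def)
  note simps = height_simps height_e[OF assms(2)]
  show ?thesis using x(1)
  proof (cases rule: root_cases)
    case (2 a b)
    then show ?thesis
      using x(2) assms(2) that(1)[of a b] that(2)[of b] by (auto simp: simps split: if_splits)
  next
    case (3 a b)
    then show ?thesis
      using x(2) assms(1) that(3)[of b] that(3)[of a]
      by (auto simp: simps add.commute split: if_splits)
  next
    case (4 a)
    then show ?thesis
      using x(2) that(4) by (auto simp: simps split: if_splits)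
  qed (use x(2) in \<open>auto simp: simps\<close>)
qed

lemma face_subset: "face i L \<subseteq> V"
  by (auto simp: face_def)

text \<open>On the face a coordinate in \<open>L\<close> is never positive, so the negative entry at
  \<open>b\<close> cannot be cancelled.\<close>

lemma face_sink:
  assumes "\<not> doubles" "L \<subseteq> {..<i}" "set_mset M \<subseteq> face i L" "e a - e b \<in># M" "b \<in> L" "a \<noteq> b"
  shows "Poly_Mapping.lookup (sum_mset M) b < 0"
  unfolding lookup_sum_mset
proof (rule sum_mset_neg)
  fix x assume "x \<in># M"
  then have "x \<in> face i L" using assms(3) by blast
  with assms(1,2) show "Poly_Mapping.lookup x b \<le> 0"
    by (cases rule: face_cases) (use assms(2,5) in \<open>auto simp: lookup_minus lookup_add lookup_e\<close>)
qed (use assms(4-6) in \<open>auto simp: lookup_minus lookup_e\<close>)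

text \<open>Dually, a coordinate below \<open>i\<close> and outside \<open>L\<close> is never
  negative on the face.\<close>

lemma face_source:
  assumes "\<not> doubles" "L \<subseteq> {..<i}" "set_mset M \<subseteq> face i L" "e a - e b \<in># M"
    "a < i" "a \<notin> L" "a \<noteq> b"
  shows "0 < Poly_Mapping.lookup (sum_mset M) a"
  unfolding lookup_sum_mset
proof (rule sum_mset_pos)
  fix x assume "x \<in># M"
  then have "x \<in> face i L" using assms(3) by blast
  with assms(1,2) show "0 \<le> Poly_Mapping.lookup x a"
    by (cases rule: face_cases) (use assms(2,5,6) in \<open>auto simp: lookup_minus lookup_add lookup_e\<close>)
qed (use assms(4-7) in \<open>auto simp: lookup_minus lookup_e\<close>)

text \<open>Minimality of \<open>k\<close> and \<open>l\<close> makes the exchange legal: an edge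
  \<open>e a - e l\<close> of \<open>M\<close> has \<open>k \<le> a\<close>, and an edge
  \<open>e k - e l'\<close> of \<open>M\<close> has \<open>l \<le> l'\<close>, so after exchanging
  the ends each tail is still below its head. If \<open>k\<close> occurs in \<open>e i + e k\<close>
  instead, then \<open>a\<close> takes its place there.\<close>

lemma face_move_edge:
  assumes "\<not> doubles" "L \<subseteq> {..<i}" "set_mset M \<subseteq> face i L"
    and l: "l \<in> L" "Poly_Mapping.lookup (sum_mset M) l < 0"
      "\<And>j. j \<in> L \<Longrightarrow> Poly_Mapping.lookup (sum_mset M) j < 0 \<Longrightarrow> l \<le> j"
    and k: "k < i" "k \<notin> L" "Poly_Mapping.lookup (sum_mset M) k > 0"
      "\<And>j. j < i \<Longrightarrow> j \<notin> L \<Longrightarrow> Poly_Mapping.lookup (sum_mset M) j > 0 \<Longrightarrow> k \<le> j"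
  obtains M' where "conn V M M'" "e k - e l \<in># M'"
proof -
  have MV: "set_mset M \<subseteq> V" using assms(3) face_subset by blast
  have li: "l < i" using l(1) assms(2) by auto
  note sink = face_sink[OF assms(1-3)] and source = face_source[OF assms(1-3)]
  obtain x where x: "x \<in># M" "Poly_Mapping.lookup x l < 0"
    using l(2) unfolding lookup_sum_mset by (meson sum_mset_negD)
  obtain a where a: "a < l" "l < d" "x = e a - e l"
    using x MV by (auto elim: root_lookup_neg)
  have "height i L x = 1" using x(1) assms(3) by (auto simp: face_def)
  then have "a \<notin> L" using a l(1) li by (auto simp: height_simps height_e[OF assms(2)])
  then have ka: "k \<le> a" using source[of a l] x(1) a li by (intro k(4)) auto
  obtain y where y: "y \<in># M" "Poly_Mapping.lookup y k > 0"
    using k(3) unfolding lookup_sum_mset by (meson sum_mset_posD)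
  show ?thesis
  proof (cases "k = a")
    case True
    then show ?thesis using that[of M] x a by simp
  next
    case False
    have xy: "x \<noteq> y" using y(2) a False ka by (auto simp: lookup_minus lookup_e split: if_splits)
    have kl: "e k - e l \<in> V" using ka a by (intro neg_root) auto
    have "y \<in> face i L" using y(1) assms(3) by blast
    with assms(1,2) show ?thesis
    proof (cases rule: face_cases)
      case (1 k' l')
      then have [simp]: "k' = k" using y(2) by (auto simp: lookup_minus lookup_e split: if_splits)
      have "l \<le> l'" using 1 y(1) sink[of k' l'] l(3)[of l'] by auto
      then have al: "e a - e l' \<in> V" using 1 a by (intro neg_root) auto
      have eq: "x + y = (e k - e l) + (e a - e l')" using 1 a by simp
      show ?thesis
        by (rule conn_swap_distinct[OF x(1) y(1) xy MV kl al eq]) (rule that)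
    next
      case (2 j)
      then show ?thesis using y(2) k(1) by (auto simp: lookup_minus lookup_e split: if_splits)
    next
      case (3 k')
      then have [simp]: "k' = k" using y(2) k(1) by (auto simp: lookup_add lookup_e split: if_splits)
      have ia: "e i + e a \<in> V" using 3 a li by (intro pos_root) auto
      have eq: "x + y = (e k - e l) + (e i + e a)" using 3 a by simp
      show ?thesis
        by (rule conn_swap_distinct[OF x(1) y(1) xy MV kl ia eq]) (rule that)
    next
      case 4
      then show ?thesis using y(2) k(1) by (auto simp: lookup_minus lookup_e split: if_splits)
    qed
  qed
qed


text \<open>A negative sink forces an edge into it, and the tail of that edge is a positive source.
  Hence both extremal indices exist, and they depend on the common sum alone.\<close>

lemma face_share_edge:
  assumes "\<not> doubles" "L \<subseteq> {..<i}" "same_fiber V M N"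
    "set_mset M \<subseteq> face i L" "set_mset N \<subseteq> face i L"
    and "\<exists>l\<in>L. Poly_Mapping.lookup (sum_mset M) l < 0"
  shows "share V M N"
proof -
  obtain l where l: "l \<in> L" "Poly_Mapping.lookup (sum_mset M) l < 0"
      "\<And>j. j \<in> L \<Longrightarrow> Poly_Mapping.lookup (sum_mset M) j < 0 \<Longrightarrow> l \<le> j"
    using obtain_least[OF assms(6)[unfolded Bex_def]] by metis
  obtain x where x: "x \<in># M" "Poly_Mapping.lookup x l < 0"
    using l(2) unfolding lookup_sum_mset by (meson sum_mset_negD)
  have "x \<in> V" using x assms(4) face_subset by blast
  then obtain a where a: "a < l" "x = e a - e l"
    using x by (auto elim: root_lookup_neg)
  have li: "l < i" using l(1) assms(2) by auto
  have "height i L x = 1" using x(1) assms(4) by (auto simp: face_def)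
  then have "a \<notin> L" using a l(1) li by (auto simp: height_simps height_e[OF assms(2)])
  moreover from this have "0 < Poly_Mapping.lookup (sum_mset M) a"
    using face_source[OF assms(1,2,4), of a l] x(1) a li by auto
  ultimately have "\<exists>k. k < i \<and> k \<notin> L \<and> 0 < Poly_Mapping.lookup (sum_mset M) k"
    using a li by (intro exI[of _ a]) auto
  then obtain k where k: "k < i" "k \<notin> L" "Poly_Mapping.lookup (sum_mset M) k > 0"
      "\<And>j. j < i \<Longrightarrow> j \<notin> L \<Longrightarrow> Poly_Mapping.lookup (sum_mset M) j > 0 \<Longrightarrow> k \<le> j"
    by (rule obtain_least) blast
  have s: "sum_mset M = sum_mset N" using assms(3) by (simp add: same_fiber_def)
  obtain M' where M': "conn V M M'" "e k - e l \<in># M'"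
    by (rule face_move_edge[OF assms(1,2,4) l k])
  obtain N' where "conn V N N'" "e k - e l \<in># N'"
    by (rule face_move_edge[OF assms(1,2,5) l(1) l(2,3)[unfolded s] k(1,2) k(3,4)[unfolded s]])
  with M' show ?thesis by (blast intro: shareI)
qed

text \<open>An edge into a sink would leave a negative coordinate in the sum, so only the roots with
  entry 1 at \<open>i\<close> remain.\<close>

lemma face_star_cases:
  assumes "\<not> doubles" "L \<subseteq> {..<i}" "set_mset M \<subseteq> face i L"
    "\<forall>l\<in>L. 0 \<le> Poly_Mapping.lookup (sum_mset M) l" "x \<in># M"
  obtains j where "i < j" "j < d" "x = e i - e j"
  | k where "pairs" "i < d" "k < d" "k \<noteq> i" "x = e i + e k"
  | "singles" "i < d" "x = e i"
proof -
  have "x \<in> face i L" using assms(3,5) by blast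
  with assms(1,2) show ?thesis
  proof (cases rule: face_cases)
    case (1 k l)
    then show ?thesis using face_sink[OF assms(1-3), of k l] assms(4,5) by force
  qed (use that in blast)+
qed

text \<open>An entry away from \<open>i\<close> must be cancelled by one of the opposite sign, and
  among the remaining roots the only partner of \<open>e i - e j\<close> is
  \<open>e i + e j\<close>.\<close>

lemma face_star_balanced:
  assumes "\<not> doubles" "L \<subseteq> {..<i}" "set_mset M \<subseteq> face i L" "M \<noteq> {#}"
    and bal: "\<And>j. j \<noteq> i \<Longrightarrow> Poly_Mapping.lookup (sum_mset M) j = 0"
  shows "singles \<and> i < d \<and> e i \<in># M \<or> (\<exists>j. i < j \<and> j < d \<and> pairs \<and> e i - e j \<in># M \<and> e i + e j \<in># M)"
proof -
  have nn: "\<forall>l\<in>L. 0 \<le> Poly_Mapping.lookup (sum_mset M) l"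
    using bal assms(2) by fastforce
  note cases = face_star_cases[OF assms(1-3) nn]
  have neg: "\<exists>y\<in>#M. Poly_Mapping.lookup y j < 0" if "x \<in># M" "0 < Poly_Mapping.lookup x j" "j \<noteq> i" for x j
    using sum_mset_pos[of M "\<lambda>x. Poly_Mapping.lookup x j" x] bal[OF that(3)] that(1,2)
    by (force simp: lookup_sum_mset not_less)
  have pos: "\<exists>y\<in>#M. 0 < Poly_Mapping.lookup y j" if "x \<in># M" "Poly_Mapping.lookup x j < 0" "j \<noteq> i" for x j
    using sum_mset_neg[of M "\<lambda>x. Poly_Mapping.lookup x j" x] bal[OF that(3)] that(1,2)
    by (force simp: lookup_sum_mset not_less)
  obtain x where x: "x \<in># M" using assms(4) by blast
  from x show ?thesis
  proof (rule cases)
    fix j assume j: "i < j" "j < d" "x = e i - e j"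
    obtain y where y: "y \<in># M" "0 < Poly_Mapping.lookup y j"
      using pos[OF x, of j] j by (auto simp: lookup_minus lookup_e)
    from y(1) have "pairs \<and> y = e i + e j"
      by (rule cases) (use y(2) j in \<open>auto simp: lookup_minus lookup_add lookup_e split: if_splits\<close>)
    then show ?thesis using j x y by auto
  next
    fix k assume k: "pairs" "i < d" "k < d" "k \<noteq> i" "x = e i + e k"
    obtain y where y: "y \<in># M" "Poly_Mapping.lookup y k < 0"
      using neg[OF x, of k] k by (auto simp: lookup_add lookup_e)
    from y(1) have "i < k \<and> y = e i - e k"
      by (rule cases) (use y(2) k in \<open>auto simp: lookup_minus lookup_add lookup_e split: if_splits\<close>)
    then show ?thesis using k x y by auto
  qed (use x in auto)
qed

lemma double_distinct: "e i - e j \<noteq> e i + e j"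
proof
  assume "e i - e j = e i + e j"
  then have "Poly_Mapping.lookup (e i - e j) j = Poly_Mapping.lookup (e i + e j) j" by simp
  then show False by (simp add: lookup_minus lookup_add lookup_e)
qed

text \<open>When no edge into a sink is left, a nonzero coordinate \<open>j\<close> of the sum with
  \<open>j \<noteq> i\<close> pins down \<open>e i + e j\<close> or \<open>e i - e j\<close> in both
  multisets. Otherwise each multiset contains \<open>e i\<close> or a pair with sum
  \<open>2 e i\<close>, and these can be traded for one another.\<close>

lemma face_share:
  assumes "\<not> doubles" "L \<subseteq> {..<i}" "same_fiber V M N"
    "set_mset M \<subseteq> face i L" "set_mset N \<subseteq> face i L" "M \<noteq> {#}"
  shows "share V M N"
proof (cases "\<exists>l\<in>L. Poly_Mapping.lookup (sum_mset M) l < 0")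
  case True
  then show ?thesis using face_share_edge assms(1-5) by blast
next
  case False
  have s: "sum_mset M = sum_mset N" and MV: "set_mset M \<subseteq> V" and NV: "set_mset N \<subseteq> V"
    and N0: "N \<noteq> {#}"
    using assms(3,6) by (auto simp: same_fiber_def)
  have nn: "\<forall>l\<in>L. 0 \<le> Poly_Mapping.lookup (sum_mset M) l"
    using False by auto
  note M_cases = face_star_cases[OF assms(1,2,4) nn]
    and N_cases = face_star_cases[OF assms(1,2,5) nn[unfolded s]]
  consider j where "j \<noteq> i" "0 < Poly_Mapping.lookup (sum_mset M) j"
    | j where "j \<noteq> i" "Poly_Mapping.lookup (sum_mset M) j < 0"
    | "\<And>j. j \<noteq> i \<Longrightarrow> Poly_Mapping.lookup (sum_mset M) j = 0"
    by (meson linorder_neqE)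
  then show ?thesis
  proof cases
    case 1
    obtain x where x: "x \<in># M" "0 < Poly_Mapping.lookup x j"
      using 1(2) unfolding lookup_sum_mset by (meson sum_mset_posD)
    obtain y where y: "y \<in># N" "0 < Poly_Mapping.lookup y j"
      using 1(2) unfolding s lookup_sum_mset by (meson sum_mset_posD)
    have "x = e i + e j" by (rule M_cases[OF x(1)])
      (use x(2) 1(1) in \<open>auto simp: lookup_minus lookup_add lookup_e split: if_splits\<close>)
    moreover have "y = e i + e j" by (rule N_cases[OF y(1)])
      (use y(2) 1(1) in \<open>auto simp: lookup_minus lookup_add lookup_e split: if_splits\<close>)
    ultimately show ?thesis using x y by (intro shareI[of _ M M N N x]) auto
  next
    case 2
    obtain x where x: "x \<in># M" "Poly_Mapping.lookup x j < 0"
      using 2(2) unfolding lookup_sum_mset by (meson sum_mset_negD)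
    obtain y where y: "y \<in># N" "Poly_Mapping.lookup y j < 0"
      using 2(2) unfolding s lookup_sum_mset by (meson sum_mset_negD)
    have "x = e i - e j" by (rule M_cases[OF x(1)])
      (use x(2) 2(1) in \<open>auto simp: lookup_minus lookup_add lookup_e split: if_splits\<close>)
    moreover have "y = e i - e j" by (rule N_cases[OF y(1)])
      (use y(2) 2(1) in \<open>auto simp: lookup_minus lookup_add lookup_e split: if_splits\<close>)
    ultimately show ?thesis using x y by (intro shareI[of _ M M N N x]) auto
  next
    case 3
    have split: "\<exists>P'. conn V P P' \<and> e i \<in># P'"
      if "set_mset P \<subseteq> V" "singles" "i < d" "e i - e j \<in># P" "e i + e j \<in># P" for P j
      by (rule conn_swap_distinct[OF that(4,5) double_distinct that(1), of "e i" "e i"])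
        (use that single_root in auto)
    consider "singles" "i < d" "e i \<in># M" "e i \<in># N"
      | j where "singles" "i < d" "e i \<in># M" "e i - e j \<in># N" "e i + e j \<in># N"
      | j where "singles" "i < d" "e i \<in># N" "e i - e j \<in># M" "e i + e j \<in># M"
      | j j' where "i < j" "j < d" "pairs" "e i - e j \<in># N" "e i + e j \<in># N"
          "e i - e j' \<in># M" "e i + e j' \<in># M"
      using face_star_balanced[OF assms(1,2,4,6) 3] face_star_balanced[OF assms(1,2,5) N0 3[unfolded s]]
      by blast
    then show ?thesis
    proof cases
      case 1
      then show ?thesis by (intro shareI[of _ M M N N "e i"]) auto
    next
      case 2
      then obtain N' where "conn V N N'" "e i \<in># N'" using split[OF NV] by blast
      then show ?thesis using 2 by (intro shareI[of _ M M N N' "e i"]) auto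
    next
      case 3
      then obtain M' where "conn V M M'" "e i \<in># M'" using split[OF MV] by blast
      then show ?thesis using 3 by (intro shareI[of _ M M' N N "e i"]) auto
    next
      case 4
      \<comment> \<open>Both pairs have sum \<open>2 e i\<close>, so the pair at \<open>j'\<close>
        in \<open>M\<close> may be replaced by the pair at \<open>j\<close> that occurs in
        \<open>N\<close>.\<close>
      have "e i + e j \<in> V" by (rule pos_root) (use 4 in auto)
      with neg_root[OF 4(1,2)] obtain M' where "conn V M M'" "e i - e j \<in># M'"
        by (rule conn_swap_distinct[OF 4(6,7) double_distinct MV]) auto
      then show ?thesis using 4 by (intro shareI[of _ M M' N N "e i - e j"]) auto
    qed
  qed
qed


section \<open>Multisets that can be moved to contain zero, and pairs that obstruct this\<close>

definition reaches_zero :: "(nat \<Rightarrow>\<^sub>0 int) multiset \<Rightarrow> bool" where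
  "reaches_zero M \<longleftrightarrow> (\<exists>M'. conn V M M' \<and> 0 \<in># M')"

lemma reaches_zero_conn: "conn V M M' \<Longrightarrow> reaches_zero M' \<Longrightarrow> reaches_zero M"
  by (meson reaches_zero_def rtranclp_trans)

lemma reaches_zero_mono:
  assumes "reaches_zero X" "X \<subseteq># M"
  shows "reaches_zero M"
proof -
  obtain X' where "conn V X X'" "0 \<in># X'" using assms(1) by (auto simp: reaches_zero_def)
  moreover have "M = X + (M - X)" using assms(2) by (simp only: subset_mset.add_diff_inverse)
  ultimately have "conn V M (X' + (M - X))" "0 \<in># X' + (M - X)"
    using conn_add[of V X X' "M - X"] by (metis, simp)
  then show ?thesis unfolding reaches_zero_def by blast
qed

text \<open>Three elements suffice for the applications: a pair with sum \<open>2 e i\<close> and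
  one further root.\<close>

lemma reaches_zero_step:
  assumes "reaches_zero {#x, y, c#}" "a \<in> V" "b \<in> V" "x \<in> V" "y \<in> V" "a + b = x + y"
  shows "reaches_zero {#a, b, c#}"
proof -
  have "{#a, b#} \<subseteq># {#a, b, c#}" by simp
  from conn_swap[OF this assms(2-6)] show ?thesis
    using assms(1) by (auto simp: add_mset_commute intro: reaches_zero_conn)
qed

lemma reaches_zero_sum:
  assumes "{#a, b#} \<subseteq># M" "a \<in> V" "b \<in> V" "a + b \<in> V"
  shows "reaches_zero M"
  using conn_swap[OF assms zero_root] by (auto simp: reaches_zero_def)

lemma reaches_zero_sum_distinct:
  assumes "a \<in># M" "b \<in># M" "a \<noteq> b" "set_mset M \<subseteq> V" "a + b \<in> V"
  shows "reaches_zero M"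
  using conn_swap_distinct[OF assms zero_root] by (auto simp: reaches_zero_def)

text \<open>A pair with sum \<open>2 e i\<close>; when \<open>2 e i\<close> is itself a root there is no obstruction to treat.\<close>

definition special :: "nat \<Rightarrow> (nat \<Rightarrow>\<^sub>0 int) multiset \<Rightarrow> bool" where
  "special i X \<longleftrightarrow> \<not> doubles \<and> i < d \<and>
     (singles \<and> X = {#e i, e i#} \<or> (\<exists>j. pairs \<and> i < j \<and> j < d \<and> X = {#e i - e j, e i + e j#}))"

text \<open>The two copies of \<open>e i\<close> do not merge with each other, so \<open>x\<close>
  has to help: if \<open>x\<close> is not \<open>0\<close>, then either \<open>e i + x\<close> is a
  root, or a move of \<open>x\<close> and one copy of \<open>e i\<close> produces a root that merges
  with the other copy. The roots excluded by the hypotheses are those that may lie on a face of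
  height 1 at \<open>i\<close>.\<close>

lemma singles_reaches_zero:
  assumes "singles" "i < d" "x \<in> V" "Poly_Mapping.lookup x i \<noteq> 1"
    "\<And>k l. k < l \<Longrightarrow> l < i \<Longrightarrow> x \<noteq> e k - e l"
  shows "reaches_zero {#e i, x, e i#}"
  using assms(3)
proof (cases rule: root_cases)
  case 1
  then show ?thesis by (auto simp: reaches_zero_def)
next
  case (2 k l)
  have ki: "k \<noteq> i" using 2 assms(4) by (auto simp: lookup_minus lookup_e)
  consider "l = i" | "i < l" using 2 assms(5)[of k l] by force
  then show ?thesis
  proof cases
    case 1
    show ?thesis by (rule reaches_zero_sum[of "e i" x])
        (use assms 1 2 single_root in \<open>auto simp: add_mset_commute\<close>)
  next
    case il: 2
    have ik: "e k + e i \<in> V" by (rule pos_root) (use singles_pairs assms(1,2) ki 2 in auto)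
    show ?thesis
    proof (rule reaches_zero_step)
      show "reaches_zero {#e i - e l, e k, e i#}"
        by (rule reaches_zero_sum[of "e k" "e i"])
          (use ik 2 assms single_root in \<open>auto simp: add_mset_commute\<close>)
    qed (use assms 2 il single_root neg_root in auto)
  qed
next
  case (3 k l)
  have kl: "k \<noteq> i" "l \<noteq> i" "k \<noteq> l"
    using 3 assms(1,4) singles_doubles by (auto simp: lookup_add lookup_e)
  have il: "e l + e i \<in> V" "e k + e i \<in> V" by (rule pos_root; use kl 3 assms(2) in blast)+
  show ?thesis
  proof (rule reaches_zero_step)
    show "reaches_zero {#e k + e i, e l, e i#}"
      by (rule reaches_zero_sum[of "e l" "e i"])
        (use il 3 assms single_root in \<open>auto simp: add_mset_commute\<close>)
  qed (use assms(1,2,3) 3(2,3,5) il single_root in \<open>simp_all add: algebra_simps\<close>)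
next
  case (4 k)
  have ki: "k \<noteq> i" using 4 assms(4) by (auto simp: lookup_e)
  have "e i + x \<in> V" unfolding 4 by (rule pos_root) (use singles_pairs assms(1,2) ki 4 in auto)
  then show ?thesis
    by (intro reaches_zero_sum[of "e i" x]) (use assms single_root in \<open>auto simp: add_mset_commute\<close>)
qed

text \<open>The index \<open>j\<close> of a pair \<open>e i - e j\<close>, \<open>e i + e j\<close>
  is free: it can be changed to any \<open>l\<close> above \<open>i\<close>, hence chosen so that it
  cancels an entry of \<open>x\<close> above \<open>i\<close>.\<close>

lemma special_reaches_zero:
  assumes "special i X" "x \<in> V" "Poly_Mapping.lookup x i \<noteq> 1"
    "\<And>k l. k < l \<Longrightarrow> l < i \<Longrightarrow> x \<noteq> e k - e l"
  shows "reaches_zero (X + {#x#})"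
proof -
  have nd: "\<not> doubles" and i: "i < d" using assms(1) by (auto simp: special_def)
  consider "singles" "X = {#e i, e i#}" | j where "pairs" "i < j" "j < d" "X = {#e i - e j, e i + e j#}"
    using assms(1) unfolding special_def by blast
  then show ?thesis
  proof cases
    case 1
    then show ?thesis using singles_reaches_zero[OF 1(1) i assms(2-4)] by (simp add: add_mset_commute)
  next
    case j: 2
    have pr: "e a + e b \<in> V" if "a < d" "b < d" "a \<noteq> b" for a b
      by (rule pos_root) (use that j(1) in auto)
    have change: "reaches_zero {#e i - e j, e i + e j, x#}" if "reaches_zero {#e i - e l, e i + e l, x#}"
      "i < l" "l < d" for l
      by (rule reaches_zero_step[OF that(1)]) (use that i j pr neg_root in auto)
    have "reaches_zero {#e i - e j, e i + e j, x#}"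
      using assms(2)
    proof (cases rule: root_cases)
      case 1
      then show ?thesis by (auto simp: reaches_zero_def)
    next
      case (2 k l)
      have ki: "k \<noteq> i" using 2 assms(3) by (auto simp: lookup_minus lookup_e)
      consider "l = i" | "i < l" using 2 assms(4)[of k l] by force
      then show ?thesis
      proof cases
        case 1
        have "(e i + e j) + x = e k + e j" using 1 2 by simp
        moreover have "e k + e j \<in> V" by (rule pr) (use 1 2 j in auto)
        ultimately have "(e i + e j) + x \<in> V" by (simp only:)
        then show ?thesis
          by (intro reaches_zero_sum[of "e i + e j" x])
            (use i j assms(2) pr[of i j] in \<open>auto simp: add_mset_commute\<close>)
      next
        case il: 2
        have "(e i + e l) + x = e i + e k" using 2 by simp
        then have "reaches_zero {#e i - e l, e i + e l, x#}"
          by (intro reaches_zero_sum[of "e i + e l" x])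
            (use il 2 i assms(2) ki pr[of i k] pr[of i l] in \<open>auto simp: add_mset_commute\<close>)
        then show ?thesis using change il 2 by blast
      qed
    next
      case (3 k l)
      have kl: "k \<noteq> i" "l \<noteq> i" "k \<noteq> l"
        using 3 assms(3) nd by (auto simp: lookup_add lookup_e)
      have up: ?thesis if "x = e k + e l" "i < k" "k < d" "l < d" "l \<noteq> i" "k \<noteq> l" for k l
      proof -
        have "(e i - e k) + x = e i + e l" using that by simp
        then have "reaches_zero {#e i - e k, e i + e k, x#}"
          by (intro reaches_zero_sum[of "e i - e k" x])
            (use that i assms(2) pr[of i l] neg_root[of i k] in \<open>auto simp: add_mset_commute\<close>)
        then show ?thesis using change that by blast
      qed
      consider "i < k" | "i < l" | "k < i" "l < i" using kl by linarith
      then show ?thesis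
      proof cases
        case 1
        then show ?thesis using up[of k l] 3 kl by blast
      next
        case 2
        then show ?thesis using up[of l k] 3 kl by (simp add: add.commute)
      next
        \<comment> \<open>No entry of \<open>x\<close> cancels against the pair here. Exchanging
          \<open>j\<close> with \<open>k\<close> between \<open>e i + e j\<close> and
          \<open>x\<close> yields \<open>e j + e l\<close>, which merges with
          \<open>e i - e j\<close>.\<close>
        case lt: 3
        have *: "(e i - e j) + (e j + e l) = e i + e l" by simp
        have r: "reaches_zero {#e i + e k, e j + e l, e i - e j#}"
          by (rule reaches_zero_sum[of "e i - e j" "e j + e l"])
            (use * kl i j 3(2,3) lt pr[of i l] pr[of j l] neg_root[of i j] in \<open>auto simp: add_mset_commute\<close>)
        have "reaches_zero {#e i + e j, x, e i - e j#}"
          by (rule reaches_zero_step[OF r])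
            (use i j kl lt 3(2,3,5) assms(2) pr[of i j] pr[of i k] pr[of j l] in \<open>auto simp: algebra_simps\<close>)
        then show ?thesis by (simp add: add_mset_commute)
      qed
    next
      \<comment> \<open>Since singles are roots, the pair can be traded for two copies of
        \<open>e i\<close>.\<close>
      case (4 k)
      have "reaches_zero {#e i, e i, x#}"
        using singles_reaches_zero[OF 4(1) i assms(2-4)] by (simp add: add_mset_commute)
      then show ?thesis
        by (rule reaches_zero_step) (use i j 4 pr[of i j] neg_root[of i j] single_root[of i] in auto)
    qed
    then show ?thesis using j by (simp add: add_mset_commute)
  qed
qed

text \<open>The members of the pair have entry 1 at \<open>i\<close>, so an offending
  \<open>x\<close> is none of them. Then the pair and \<open>x\<close> together form a submultiset
  that reaches \<open>0\<close>.\<close>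

lemma special_elements:
  assumes "\<not> reaches_zero N" "set_mset N \<subseteq> V" "special i X" "X \<subseteq># N" "x \<in># N"
  shows "Poly_Mapping.lookup x i = 1 \<or> (\<exists>k l. k < l \<and> l < i \<and> x = e k - e l)"
proof (rule ccontr)
  assume neg: "\<not> ?thesis"
  have "x \<notin># X" using neg assms(3)
    by (auto simp: special_def lookup_minus lookup_add lookup_e)
  have "X + {#x#} \<subseteq># N"
  proof (rule mset_subset_eqI)
    fix a show "count (X + {#x#}) a \<le> count N a"
      using mset_subset_eq_count[OF assms(4), of a] \<open>x \<notin># X\<close> assms(5)
      by (auto simp: not_in_iff count_greater_zero_iff Suc_le_eq)
  qed
  moreover have "reaches_zero (X + {#x#})"
    using neg assms(2,5) by (intro special_reaches_zero[OF assms(3)]) auto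
  ultimately show False using assms(1) reaches_zero_mono by blast
qed

text \<open>\<open>L\<close> consists of the heads below \<open>i\<close> of the edges in
  \<open>N\<close>. An element with a positive entry at such a head would merge with the edge, so
  \<open>N\<close> treats these indices as pure sinks.\<close>

lemma special_face:
  assumes "\<not> reaches_zero N" "set_mset N \<subseteq> V" "special i X" "X \<subseteq># N"
  obtains L where "L \<subseteq> {..<i}" "set_mset N \<subseteq> face i L"
proof
  let ?L = "{l. l < i \<and> (\<exists>k<l. e k - e l \<in># N)}"
  show L: "?L \<subseteq> {..<i}" by auto
  have nd: "\<not> doubles" using assms(3) by (simp add: special_def)
  note elements = special_elements[OF assms]
  have no_source: "Poly_Mapping.lookup x l \<le> 0" if l: "l \<in> ?L" and x: "x \<in># N" for l x
  proof (rule ccontr)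
    assume pos: "\<not> ?thesis"
    obtain k where k: "k < l" "l < i" "e k - e l \<in># N" using l by blast
    have ne: "e k - e l \<noteq> x" using pos k by (auto simp: lookup_minus lookup_e)
    have "(e k - e l) + x \<in> V"
    proof (rule root_lookup_pos[of x l])
      fix m assume "l < m" "m < d" "x = e l - e m"
      then show ?thesis using k neg_root[of k m] by simp
    next
      fix y assume y: "pairs" "l < d" "y < d" "l \<noteq> y \<or> doubles" "x = e l + e y"
      \<comment> \<open>For \<open>y = k\<close> the sum would be \<open>2 e k\<close>, which is not
        a root. But then \<open>x\<close> has entry 0 at \<open>i\<close> and no negative entry,
        which contradicts the known shape of the elements of \<open>N\<close>.\<close>
      have "y \<noteq> k"
      proof
        assume "y = k"
        then have "Poly_Mapping.lookup x i = 0" using y k by (simp add: lookup_add lookup_e)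
        then obtain a b where "a < b" "x = e a - e b" using elements[OF x] by auto
        then have "Poly_Mapping.lookup x b < 0" by (simp add: lookup_minus lookup_e)
        then show False using y by (simp add: lookup_add lookup_e split: if_splits)
      qed
      then show ?thesis using pos_root[of k y] y k by auto
    next
      assume "singles" "l < d" "x = e l"
      then show ?thesis using single_root[of k] k by simp
    qed (use x assms(2) pos in auto)
    then show False
      using reaches_zero_sum_distinct[OF k(3) x ne assms(2)] assms(1) by blast
  qed
  show "set_mset N \<subseteq> face i ?L"
  proof
    fix x assume x: "x \<in># N"
    then have xV: "x \<in> V" using assms(2) by blast
    note simps = height_simps height_e[OF L]
    have "height i ?L x = 1"
      using elements[OF x]
    proof (elim disjE exE conjE)
      assume x1: "Poly_Mapping.lookup x i = 1"
      from xV show ?thesis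
      proof (cases rule: root_cases)
        case (2 a b)
        then show ?thesis using x1 by (auto simp: simps lookup_minus lookup_e split: if_splits)
      next
        case (3 a b)
        have "0 < Poly_Mapping.lookup x a" "0 < Poly_Mapping.lookup x b"
          using 3 by (auto simp: lookup_add lookup_e)
        then have "a \<notin> ?L" "b \<notin> ?L" using no_source[OF _ x] by (meson not_less)+
        then show ?thesis using 3(4,5) x1 nd
          by (auto simp only: simps lookup_add lookup_e split: if_splits)
      qed (use x1 in \<open>auto simp: simps lookup_e split: if_splits\<close>)
    next
      fix k l assume kl: "k < l" "l < i" "x = e k - e l"
      then have "l \<in> ?L" using x by blast
      moreover have "0 < Poly_Mapping.lookup x k" using kl by (simp add: lookup_minus lookup_e)
      then have "k \<notin> ?L" using no_source[OF _ x] by (meson not_less)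
      ultimately show ?thesis using kl by (simp only: simps) simp
    qed
    then show "x \<in> face i ?L" using xV by (simp add: face_def)
  qed
qed

text \<open>\<open>N\<close> lies on a face, and the rest of the fiber follows it there. As
  \<open>0\<close> has height 0, it occurs in no multiset of the fiber.\<close>

lemma special_share:
  assumes "same_fiber V M N" "M \<noteq> {#}" "\<not> reaches_zero N" "special i X" "X \<subseteq># N"
  shows "0 \<notin># M" "share V M N"
proof -
  have NV: "set_mset N \<subseteq> V" using assms(1) by (simp add: same_fiber_def)
  have nd: "\<not> doubles" using assms(4) by (simp add: special_def)
  obtain L where L: "L \<subseteq> {..<i}" "set_mset N \<subseteq> face i L"
    by (rule special_face[OF assms(3) NV assms(4,5)])
  have "height i L x = 1" if "x \<in># M" for x
    by (rule face_transfer[of "height i L" V M N, OF height_simps(1,2) assms(1) face_bound[OF nd L(1)] _ that])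
      (use L(2) in \<open>auto simp: face_def\<close>)
  then have M: "set_mset M \<subseteq> face i L" using assms(1) by (auto simp: face_def same_fiber_def)
  then show "0 \<notin># M" by (auto simp: face_def height_simps)
  show "share V M N" by (rule face_share[OF nd L(1) assms(1) M L(2) assms(2)])
qed


section \<open>Coherent multisets\<close>

definition coherent :: "(nat \<Rightarrow>\<^sub>0 int) multiset \<Rightarrow> bool" where
  "coherent M \<longleftrightarrow> set_mset M \<subseteq> V \<and> 0 \<notin># M \<and>
     (\<forall>x\<in>#M. \<forall>y\<in>#M. \<forall>j. \<not> (0 < Poly_Mapping.lookup x j \<and> Poly_Mapping.lookup y j < 0))"

abbreviation single_roots :: "(nat \<Rightarrow>\<^sub>0 int) set" where
  "single_roots \<equiv> range e"

lemma coherent_pos: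
  assumes "coherent M" "x \<in># M" "0 < Poly_Mapping.lookup x j"
  shows "0 < Poly_Mapping.lookup (sum_mset M) j" "y \<in># M \<Longrightarrow> 0 \<le> Poly_Mapping.lookup y j"
proof -
  show *: "0 \<le> Poly_Mapping.lookup y j" if "y \<in># M" for y
    using assms that by (auto simp: coherent_def not_less[symmetric])
  show "0 < Poly_Mapping.lookup (sum_mset M) j"
    unfolding lookup_sum_mset by (rule sum_mset_pos[of M _ x]) (use * assms in auto)
qed

lemma coherent_neg:
  assumes "coherent M" "x \<in># M" "Poly_Mapping.lookup x j < 0"
  shows "Poly_Mapping.lookup (sum_mset M) j < 0"
  unfolding lookup_sum_mset
proof (rule sum_mset_neg)
  show "Poly_Mapping.lookup y j \<le> 0" if "y \<in># M" for y
    using assms that by (auto simp: coherent_def not_less[symmetric])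
qed (use assms in auto)

lemma coherent_cases:
  assumes "coherent M" "x \<in># M"
  obtains i j where "i < j" "j < d" "x = e i - e j"
    "0 < Poly_Mapping.lookup (sum_mset M) i" "Poly_Mapping.lookup (sum_mset M) j < 0"
  | i j where "pairs" "i < d" "j < d" "i \<noteq> j \<or> doubles" "x = e i + e j"
    "0 < Poly_Mapping.lookup (sum_mset M) i" "0 < Poly_Mapping.lookup (sum_mset M) j"
  | i where "singles" "i < d" "x = e i" "0 < Poly_Mapping.lookup (sum_mset M) i"
proof -
  have "x \<in> V" "x \<noteq> 0" using assms by (auto simp: coherent_def)
  from this(1) show ?thesis
  proof (cases rule: root_cases)
    case (2 i j)
    then show ?thesis
      using that(1)[of i j] coherent_pos(1)[OF assms, of i] coherent_neg[OF assms, of j]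
      by (simp add: lookup_minus lookup_e)
  next
    case (3 i j)
    then show ?thesis
      using that(2)[of i j] coherent_pos(1)[OF assms, of i] coherent_pos(1)[OF assms, of j]
      by (simp add: lookup_add lookup_e)
  next
    case (4 i)
    then show ?thesis
      using that(3)[of i] coherent_pos(1)[OF assms, of i] by (simp add: lookup_e)
  qed (use \<open>x \<noteq> 0\<close> in blast)
qed

text \<open>Opposite entries at \<open>j\<close> let two elements merge. The only exception is the
  pair \<open>e k - e j\<close>, \<open>e j + e k\<close> when \<open>2 e k\<close> is not a root,
  and this pair is special.\<close>

lemma nonspecial_coherent:
  assumes "\<not> reaches_zero N" "set_mset N \<subseteq> V" "\<And>i X. special i X \<Longrightarrow> \<not> X \<subseteq># N"
  shows "coherent N"
  unfolding coherent_def
proof (intro conjI ballI allI notI)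
  show "set_mset N \<subseteq> V" by fact
  show "0 \<in># N \<Longrightarrow> False" using assms(1) by (auto simp: reaches_zero_def)
next
  fix x y j
  assume x: "x \<in># N" and y: "y \<in># N"
    and "0 < Poly_Mapping.lookup x j \<and> Poly_Mapping.lookup y j < 0"
  then have pos: "0 < Poly_Mapping.lookup x j" and neg: "Poly_Mapping.lookup y j < 0"
    and ne: "y \<noteq> x" by auto
  obtain k where k: "k < j" "j < d" "y = e k - e j"
    using y assms(2) neg by (auto elim: root_lookup_neg)
  have "y + x \<in> V"
  proof (rule root_lookup_pos[of x j])
    fix m assume "j < m" "m < d" "x = e j - e m"
    then show ?thesis using k neg_root[of k m] by simp
  next
    fix z assume z: "pairs" "j < d" "z < d" "j \<noteq> z \<or> doubles" "x = e j + e z"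
    have "k \<noteq> z \<or> doubles"
    proof (rule ccontr)
      assume c: "\<not> ?thesis"
      then have "special k {#y, x#}"
        using k z unfolding special_def by (auto simp: add.commute)
      moreover have "{#y, x#} \<subseteq># N"
        using x y ne by (simp add: insert_subset_eq_iff in_diff_count)
      ultimately show False using assms(3) by blast
    qed
    then show ?thesis using pos_root[of k z] z k by auto
  next
    assume "singles" "j < d" "x = e j"
    then show ?thesis using single_root[of k] k by simp
  qed (use x assms(2) pos in auto)
  then show False using reaches_zero_sum_distinct[OF y x ne assms(2)] assms(1) by blast
qed

text \<open>Two different single roots have a root as their sum; two equal ones form a special
  pair.\<close>

lemma nonspecial_single_roots:
  assumes "\<not> reaches_zero N" "set_mset N \<subseteq> V" "\<And>i X. special i X \<Longrightarrow> \<not> X \<subseteq># N"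
  shows "size (filter_mset (\<lambda>x. x \<in> single_roots) N) \<le> 1"
proof (rule ccontr)
  let ?F = "filter_mset (\<lambda>x. x \<in> single_roots) N"
  assume "\<not> ?thesis"
  then have sz: "2 \<le> size ?F" by simp
  then obtain x G where G: "?F = add_mset x G" by (cases ?F) auto
  then obtain y F where F: "?F = {#x, y#} + F" using sz by (cases G) auto
  then have xyN: "{#x, y#} \<subseteq># N" by (metis mset_subset_eq_add_left multiset_filter_subset subset_mset.trans)
  have "x \<in># ?F" "y \<in># ?F" using F by auto
  then obtain i j where ij: "x = e i" "y = e j" "x \<in> V" "y \<in> V" using assms(2) by auto
  have root: "singles \<and> k < d" if "e k \<in> V" for k
    using that
  proof (cases rule: root_lookup_pos[of "e k" k])
    case (2 l)
    have "Poly_Mapping.lookup (e k) l = Poly_Mapping.lookup (e k - e l) l" using 2(3) by simp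
    then show ?thesis using 2 by (simp add: lookup_minus lookup_e split: if_splits)
  next
    case (3 l)
    have "Poly_Mapping.lookup (e k) l = Poly_Mapping.lookup (e k + e l) l" using 3(5) by simp
    then show ?thesis by (simp add: lookup_add lookup_e split: if_splits)
  qed (simp_all add: lookup_e)
  have s: "singles" "i < d" "j < d" using root[of i] root[of j] ij by auto
  show False
  proof (cases "i = j")
    case True
    then have "{#x, y#} = {#e i, e i#}" using ij by simp
    then have "special i {#x, y#}" unfolding special_def using s singles_doubles by blast
    then show False using assms(3) xyN by blast
  next
    case False
    then have "x + y \<in> V" unfolding ij by (intro pos_root) (use s singles_pairs in auto)
    then show False using reaches_zero_sum[OF xyN] ij assms(1) by blast
  qed
qed

text \<open>The linear functional given by the sign pattern of \<open>s\<close>. If \<open>s\<close>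
  is the sum of a coherent multiset, each entry of each element contributes its absolute value, so
  that an element has weight 2, or 1 if it is a single root.\<close>

definition weight :: "(nat \<Rightarrow>\<^sub>0 int) \<Rightarrow> (nat \<Rightarrow>\<^sub>0 int) \<Rightarrow> int" where
  "weight s x = (\<Sum>j<d. sgn (Poly_Mapping.lookup s j) * Poly_Mapping.lookup x j)"

lemma weight_simps:
  "weight s 0 = 0" "weight s (x + y) = weight s x + weight s y"
  "weight s (x - y) = weight s x - weight s y"
  by (simp_all add: weight_def lookup_add lookup_minus algebra_simps sum.distrib sum_subtractf)

lemma weight_e: "i < d \<Longrightarrow> weight s (e i) = sgn (Poly_Mapping.lookup s i)"
  by (simp add: weight_def lookup_e if_distrib[of "(*) _"] cong: if_cong)

lemma weight_le_2: "x \<in> V \<Longrightarrow> weight s x \<le> 2"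
proof (erule root_cases)
qed (auto simp: weight_simps weight_e sgn_if)

lemma e_neq: "e k \<noteq> e i - e j" "i \<noteq> j \<Longrightarrow> e k \<noteq> e i + e j" "e k \<noteq> e i + e i"
proof -
  show "e k \<noteq> e i - e j"
  proof
    assume eq: "e k = e i - e j"
    have "Poly_Mapping.lookup (e k) j = Poly_Mapping.lookup (e i - e j) j"
      "Poly_Mapping.lookup (e k) i = Poly_Mapping.lookup (e i - e j) i" 
      "Poly_Mapping.lookup (e k) k = Poly_Mapping.lookup (e i - e j) k" unfolding eq by simp_all
    then show False by (auto simp: lookup_minus lookup_e split: if_splits)
  qed
  show "e k \<noteq> e i + e j" if "i \<noteq> j"
  proof
    assume eq: "e k = e i + e j"
    have "Poly_Mapping.lookup (e k) j = Poly_Mapping.lookup (e i + e j) j"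
      "Poly_Mapping.lookup (e k) i = Poly_Mapping.lookup (e i + e j) i" unfolding eq by simp_all
    then show False using that by (auto simp: lookup_add lookup_e split: if_splits)
  qed
  show "e k \<noteq> e i + e i"
  proof
    assume eq: "e k = e i + e i"
    have "Poly_Mapping.lookup (e k) i = Poly_Mapping.lookup (e i + e i) i" by (simp only: eq)
    then show False by (simp only: lookup_add lookup_e) (simp split: if_splits)
  qed
qed

lemma coherent_weight:
  assumes "coherent N" "x \<in># N"
  shows "weight (sum_mset N) x = 2 - (if x \<in> single_roots then 1 else 0)"
  using assms
proof (cases rule: coherent_cases)
  case (1 i j)
  then show ?thesis by (auto simp: weight_simps weight_e e_neq(1)[symmetric])
next
  case (2 i j)
  then have "x \<notin> single_roots" using e_neq(2)[of i j] e_neq(3)[of _ i] by (cases "i = j") force+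
  then show ?thesis using 2 by (auto simp: weight_simps weight_e)
qed (auto simp: weight_e)

lemma coherent_weight_sum:
  assumes "coherent N"
  shows "weight (sum_mset N) (sum_mset N) =
    2 * int (size N) - int (size (filter_mset (\<lambda>x. x \<in> single_roots) N))"
proof -
  have count: "(\<Sum>x\<in>#M. 2 - (if x \<in> single_roots then 1 else 0)) =
    2 * int (size M) - int (size (filter_mset (\<lambda>x. x \<in> single_roots) M))" for M
    by (induction M) auto
  have "weight (sum_mset N) (sum_mset N) = (\<Sum>x\<in>#N. weight (sum_mset N) x)"
    by (rule additive_sum_mset) (simp_all add: weight_simps)
  also have "\<dots> = (\<Sum>x\<in>#N. 2 - (if x \<in> single_roots then 1 else 0))"
    by (intro arg_cong[of _ _ sum_mset] image_mset_cong coherent_weight[OF assms])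
  finally show ?thesis using count by simp
qed

text \<open>A multiset of the same size that contains \<open>0\<close> has weight at most
  \<open>2 * (size N - 1)\<close>, whereas one single root lowers the weight of \<open>N\<close>
  only to \<open>2 * size N - 1\<close>.\<close>

lemma coherent_no_zero:
  assumes "coherent N" "size (filter_mset (\<lambda>x. x \<in> single_roots) N) \<le> 1" "same_fiber V M N"
  shows "0 \<notin># M"
proof
  assume "0 \<in># M"
  then obtain X where X: "M = add_mset 0 X" by (meson mset_add)
  have MV: "set_mset M \<subseteq> V" and sz: "size M = size N" and s: "sum_mset M = sum_mset N"
    using assms(3) by (auto simp: same_fiber_def)
  have "weight (sum_mset N) (sum_mset N) = weight (sum_mset N) (sum_mset X)"
    using s X by simp
  also have "\<dots> = (\<Sum>x\<in>#X. weight (sum_mset N) x)"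
    by (rule additive_sum_mset) (simp_all add: weight_simps)
  also have "\<dots> \<le> (\<Sum>x\<in>#X. 2)"
    using MV X by (intro sum_mset_mono weight_le_2) auto
  finally have "weight (sum_mset N) (sum_mset N) \<le> 2 * int (size X)" by simp
  moreover have "int (size N) = int (size X) + 1" using sz X by simp
  ultimately show False using coherent_weight_sum[OF assms(1)] assms(2) by linarith
qed

text \<open>
  An element \<open>e a + t\<close> can be traded for \<open>e h + t\<close> unless every occurrence of \<open>h\<close> is in \<open>e h + e a\<close>,
  which would make \<open>a\<close> occur more often than \<open>h\<close>.
\<close>

lemma coherent_promote:
  assumes M: "coherent M" and x: "x \<in># M" "x = e a + t" and ha: "a \<noteq> h" "a < d"
    and s: "0 < Poly_Mapping.lookup (sum_mset M) h"
      "Poly_Mapping.lookup (sum_mset M) a \<le> Poly_Mapping.lookup (sum_mset M) h"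
    and t: "e h + t \<in> V" "Poly_Mapping.lookup t h \<le> 0" "0 \<le> Poly_Mapping.lookup t a"
    and below: "\<And>l. Poly_Mapping.lookup (sum_mset M) l < 0 \<Longrightarrow> a < l"
  obtains M' where "conn V M M'" "e h + t \<in># M'"
proof -
  have MV: "set_mset M \<subseteq> V" using M by (simp add: coherent_def)
  have xh: "Poly_Mapping.lookup x h \<le> 0" and xa: "0 < Poly_Mapping.lookup x a"
    using x(2) ha t by (auto simp: lookup_add lookup_e)
  show ?thesis
  proof (cases "\<exists>y\<in>#M. 0 < Poly_Mapping.lookup y h \<and> y - e h + e a \<in> V")
    case True
    then obtain y where y: "y \<in># M" "0 < Poly_Mapping.lookup y h" "y - e h + e a \<in> V" by blast
    have "x \<noteq> y" using xh y by auto
    then show ?thesis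
      by (rule conn_swap_distinct[OF x(1) y(1) _ MV t(1) y(3)]) (use x(2) that in auto)
  next
    case False
    have le: "Poly_Mapping.lookup y h \<le> Poly_Mapping.lookup y a" if y: "y \<in># M" for y
    proof (cases "0 < Poly_Mapping.lookup y h")
      case True
      have "y = e h + e a"
      proof (rule root_lookup_pos[of y h])
        fix l assume l: "h < l" "l < d" "y = e h - e l"
        \<comment> \<open>As \<open>a\<close> is below every index with a negative entry in the sum,
          it can replace \<open>h\<close> as the tail of this edge.\<close>
        then have "a < l" using coherent_neg[OF M y, of l] by (intro below) (simp add: lookup_minus lookup_e)
        then show ?thesis using False y True l neg_root[of a l] by force
      next
        fix z assume z: "pairs" "h < d" "z < d" "h \<noteq> z \<or> doubles" "y = e h + e z"
        show ?thesis
        proof (cases "z = a")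
          case False': False
          then have "e z + e a \<in> V" using pos_root[of z a] z ha by blast
          moreover have "y - e h + e a = e z + e a" using z by simp
          ultimately show ?thesis using False y True by metis
        qed (use z in simp)
      next
        assume "singles" "h < d" "y = e h"
        then have "y - e h + e a \<in> V" using single_root ha by simp
        then show ?thesis using False y True by blast
      qed (use y MV True in auto)
      then show ?thesis using ha by (simp add: lookup_add lookup_e)
    qed (use coherent_pos(2)[OF M x(1) xa y] in linarith)
    \<comment> \<open>Entry \<open>h\<close> is at most entry \<open>a\<close> in every element, and
      smaller in \<open>x\<close>. Summation gives a strict inequality that contradicts the choice
      of \<open>h\<close>.\<close>
    have "0 < (\<Sum>y\<in>#M. Poly_Mapping.lookup y a - Poly_Mapping.lookup y h)"
      by (rule sum_mset_pos[OF _ x(1)]) (use le xa xh in auto)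
    also have "\<dots> = Poly_Mapping.lookup (sum_mset M) a - Poly_Mapping.lookup (sum_mset M) h"
      by (induction M) (auto simp: lookup_add)
    finally show ?thesis using s(2) by simp
  qed
qed

text \<open>Some edge \<open>e a - e l\<close> is present; its tail is promoted to \<open>h\<close>.
  The maximum is taken only below \<open>l\<close> so that \<open>e h - e l\<close> is a root, and
  the minimality of \<open>l\<close> puts \<open>a\<close> below all negative coordinates.\<close>

lemma coherent_reach_edge:
  assumes "coherent M" "Poly_Mapping.lookup (sum_mset M) l < 0"
    and least: "\<And>j. Poly_Mapping.lookup (sum_mset M) j < 0 \<Longrightarrow> l \<le> j"
    and h: "h < l" "\<And>a. a < l \<Longrightarrow> Poly_Mapping.lookup (sum_mset M) a \<le> Poly_Mapping.lookup (sum_mset M) h"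
  obtains M' where "conn V M M'" "e h - e l \<in># M'"
proof -
  obtain x where x: "x \<in># M" "Poly_Mapping.lookup x l < 0"
    using assms(2) unfolding lookup_sum_mset by (meson sum_mset_negD)
  have "x \<in> V" using x assms(1) by (auto simp: coherent_def)
  then obtain a where a: "a < l" "l < d" "x = e a + (- e l)"
    using x(2) by (auto elim: root_lookup_neg)
  have pos: "0 < Poly_Mapping.lookup (sum_mset M) a"
    using coherent_pos(1)[OF assms(1) x(1), of a] a by (simp add: lookup_minus lookup_e)
  show ?thesis
  proof (cases "a = h")
    case True
    then show ?thesis using that[of M] x a by simp
  next
    case False
    show ?thesis
    proof (rule coherent_promote[OF assms(1) x(1) a(3) False])
      show "0 < Poly_Mapping.lookup (sum_mset M) h" using h(2)[OF a(1)] pos by linarith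
      show "e h + - e l \<in> V" using neg_root[of h l] h(1) a(2) by simp
      show "a < j" if "Poly_Mapping.lookup (sum_mset M) j < 0" for j using least[OF that] a(1) by simp
    qed (use a h that in \<open>auto simp: lookup_e\<close>)
  qed
qed

lemma coherent_reach_single:
  assumes "coherent M" "x \<in># M" "x \<in> single_roots"
    and "\<And>j. 0 \<le> Poly_Mapping.lookup (sum_mset M) j"
    and h: "h < d" "\<And>a. a < d \<Longrightarrow> Poly_Mapping.lookup (sum_mset M) a \<le> Poly_Mapping.lookup (sum_mset M) h"
  obtains M' where "conn V M M'" "e h \<in># M'"
proof -
  from assms(1,2) obtain a where a: "singles" "a < d" "x = e a + 0" "0 < Poly_Mapping.lookup (sum_mset M) a"
  proof (cases rule: coherent_cases)
    case (1 i j)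
    then show ?thesis using assms(3) by (auto simp: e_neq(1)[symmetric])
  next
    case (2 i j)
    then show ?thesis using assms(3) e_neq(2)[of i j] e_neq(3)[of _ i] by (cases "i = j") force+
  qed (use that in auto)
  show ?thesis
  proof (cases "a = h")
    case True
    then show ?thesis using that[of M] assms(2) a by simp
  next
    case False
    show ?thesis
    proof (rule coherent_promote[OF assms(1,2) a(3) False])
      show "0 < Poly_Mapping.lookup (sum_mset M) h" using h(2)[OF a(2)] a(4) by linarith
      show "e h + 0 \<in> V" using single_root a h by simp
    qed (use a h that assms(4) in \<open>auto simp: not_less[symmetric]\<close>)
  qed
qed

text \<open>Without negative coordinates and single roots, an element with a positive entry at
  \<open>z\<close> is \<open>e y + e z\<close>, and \<open>y\<close> is promoted to
  \<open>h\<close>.\<close>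

lemma coherent_reach_pair:
  assumes "coherent M" "\<And>x. x \<in># M \<Longrightarrow> x \<notin> single_roots"
    and "\<And>j. 0 \<le> Poly_Mapping.lookup (sum_mset M) j"
    and h: "h < d" "\<And>a. a < d \<Longrightarrow> Poly_Mapping.lookup (sum_mset M) a \<le> Poly_Mapping.lookup (sum_mset M) h"
    and z: "z \<noteq> h" "0 < Poly_Mapping.lookup (sum_mset M) z"
  obtains M' where "conn V M M'" "e h + e z \<in># M'"
proof -
  obtain x where x: "x \<in># M" "0 < Poly_Mapping.lookup x z"
    using z(2) unfolding lookup_sum_mset by (meson sum_mset_posD)
  from assms(1) x(1) obtain y where y: "pairs" "z < d" "y < d" "x = e y + e z"
  proof (cases rule: coherent_cases)
    case (1 i j)
    then show ?thesis using assms(3)[of j] by simp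
  next
    case (2 i j)
    then show ?thesis using that x(2) by (auto simp: lookup_add lookup_e add.commute split: if_splits)
  next
    case (3 i)
    then show ?thesis using assms(2)[OF x(1)] by blast
  qed
  show ?thesis
  proof (cases "y = h")
    case True
    then show ?thesis using that[of M] x y by simp
  next
    case False
    show ?thesis
    proof (rule coherent_promote[OF assms(1) x(1) y(4) False y(3)])
      show "0 < Poly_Mapping.lookup (sum_mset M) h" using h(2)[OF y(2)] z(2) by linarith
      show "e h + e z \<in> V" by (rule pos_root) (use y h z in auto)
    qed (use y h z that assms(3) in \<open>auto simp: lookup_e not_less[symmetric]\<close>)
  qed
qed

lemma coherent_double_only:
  assumes "coherent M" "\<And>x. x \<in># M \<Longrightarrow> x \<notin> single_roots" "x \<in># M"
    and "\<And>j. 0 \<le> Poly_Mapping.lookup (sum_mset M) j"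
    and "\<And>z. z \<noteq> h \<Longrightarrow> Poly_Mapping.lookup (sum_mset M) z \<le> 0"
  shows "x = e h + e h"
  using assms(1,3)
proof (cases rule: coherent_cases)
  case (1 i j)
  then show ?thesis using assms(4)[of j] by simp
next
  case (2 i j)
  then have "i = h" "j = h" using assms(5)[of i] assms(5)[of j] by force+
  then show ?thesis using 2 by simp
next
  case (3 i)
  then show ?thesis using assms(2)[OF assms(3)] by blast
qed

text \<open>The weight of the common sum determines the number of single roots, so \<open>M\<close>
  contains one exactly if \<open>N\<close> does. The same case therefore applies to both, with the
  same target.\<close>

lemma coherent_share:
  assumes M: "coherent M" and N: "coherent N" and fib: "same_fiber V M N" and ne: "M \<noteq> {#}"
  shows "share V M N"
proof -
  have s: "sum_mset N = sum_mset M" and sz: "size M = size N"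
    using fib by (auto simp: same_fiber_def)
  let ?s = "Poly_Mapping.lookup (sum_mset M)"
  show ?thesis
  proof (cases "\<exists>l. ?s l < 0")
    case True
    then obtain l where l: "?s l < 0" "\<And>j. ?s j < 0 \<Longrightarrow> l \<le> j" by (rule obtain_least) blast
    obtain x where x: "x \<in># M" "Poly_Mapping.lookup x l < 0"
      using l(1) unfolding lookup_sum_mset by (meson sum_mset_negD)
    have "x \<in> V" using x M by (auto simp: coherent_def)
    then have "0 < l" using x(2) by (auto elim: root_lookup_neg)
    then obtain h where h: "h < l" "\<And>a. a < l \<Longrightarrow> ?s a \<le> ?s h"
      using obtain_greatest[of "{..<l}" ?s] by auto
    obtain M' where "conn V M M'" "e h - e l \<in># M'"
      by (rule coherent_reach_edge[OF M l h])
    moreover obtain N' where "conn V N N'" "e h - e l \<in># N'"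
      by (rule coherent_reach_edge[OF N, unfolded s, OF l h])
    ultimately show ?thesis by (blast intro: shareI)
  next
    case False
    then have nn: "\<And>j. 0 \<le> ?s j" by (simp add: not_less)
    obtain x where x: "x \<in># M" using ne by blast
    from M x have "0 < d" by (cases rule: coherent_cases) auto
    then obtain h where h: "h < d" "\<And>a. a < d \<Longrightarrow> ?s a \<le> ?s h"
      using obtain_greatest[of "{..<d}" ?s] by auto
    have count: "size (filter_mset (\<lambda>x. x \<in> single_roots) M) = size (filter_mset (\<lambda>x. x \<in> single_roots) N)"
      using coherent_weight_sum[OF M] coherent_weight_sum[OF N] s sz by simp
    show ?thesis
    proof (cases "filter_mset (\<lambda>x. x \<in> single_roots) M = {#}")
      case False
      then have "filter_mset (\<lambda>x. x \<in> single_roots) N \<noteq> {#}" using count by force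
      with False obtain x y where "x \<in># M" "x \<in> single_roots" "y \<in># N" "y \<in> single_roots"
        by (metis (mono_tags, lifting) filter_mset_eq_mempty_iff)
      note xy = this
      obtain M' where "conn V M M'" "e h \<in># M'"
        by (rule coherent_reach_single[OF M xy(1,2) nn h])
      moreover obtain N' where "conn V N N'" "e h \<in># N'"
        by (rule coherent_reach_single[OF N xy(3,4), unfolded s, OF nn h])
      ultimately show ?thesis by (blast intro: shareI)
    next
      case True
      then have "filter_mset (\<lambda>x. x \<in> single_roots) N = {#}" using count by (metis size_eq_0_iff_empty)
      then have no: "\<And>x. x \<in># M \<Longrightarrow> x \<notin> single_roots" "\<And>x. x \<in># N \<Longrightarrow> x \<notin> single_roots"
        using True by (simp_all add: filter_mset_eq_mempty_iff)
      show ?thesis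
      proof (cases "\<exists>z. z \<noteq> h \<and> 0 < ?s z")
        case True
        then obtain z where z: "z \<noteq> h" "0 < ?s z" by blast
        obtain M' where "conn V M M'" "e h + e z \<in># M'"
          by (rule coherent_reach_pair[OF M no(1) nn h z])
        moreover obtain N' where "conn V N N'" "e h + e z \<in># N'"
          by (rule coherent_reach_pair[OF N no(2), unfolded s, OF _ nn h z])
        ultimately show ?thesis by (blast intro: shareI)
      next
        case False
        then have le: "\<And>z. z \<noteq> h \<Longrightarrow> ?s z \<le> 0" by (meson not_less)
        obtain y where y: "y \<in># N" using ne sz by fastforce
        have "x = e h + e h" by (rule coherent_double_only[OF M no(1) x nn le])
        moreover have "y = e h + e h" by (rule coherent_double_only[OF N no(2) y nn[folded s] le[folded s]])
        ultimately show ?thesis using x y by (blast intro: shareI)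
      qed
    qed
  qed
qed

text \<open>That \<open>N\<close> cannot reach \<open>0\<close> comes from a bound valid on its
  whole fiber, so \<open>M\<close> cannot reach it either. This makes the situation symmetric, and a
  special pair may be assumed in whichever multiset has one.\<close>

lemma roots_share_zero_free:
  assumes fib: "same_fiber V M N" and ne: "M \<noteq> {#}" and zf: "\<not> reaches_zero N"
  shows "share V M N"
proof -
  have no_zero: "0 \<notin># M'" if "same_fiber V M' N" for M'
  proof (cases "\<exists>i X. special i X \<and> X \<subseteq># N")
    case True
    then obtain i X where X: "special i X" "X \<subseteq># N" by blast
    have "M' \<noteq> {#}" using that fib ne by (auto simp: same_fiber_def)
    from special_share(1)[OF that this zf X] show ?thesis .
  next
    case False
    have NV: "set_mset N \<subseteq> V" using fib by (simp add: same_fiber_def)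
    have "coherent N" "size (filter_mset (\<lambda>x. x \<in> single_roots) N) \<le> 1"
      using nonspecial_coherent[OF zf NV] nonspecial_single_roots[OF zf NV] False by blast+
    from coherent_no_zero[OF this that] show ?thesis .
  qed
  have zfM: "\<not> reaches_zero M"
    using no_zero same_fiber_conn[OF fib] unfolding reaches_zero_def by blast
  have fib': "same_fiber V N M" and ne': "N \<noteq> {#}" and MV: "set_mset M \<subseteq> V" and NV: "set_mset N \<subseteq> V"
    using fib ne by (auto simp: same_fiber_def)
  consider i X where "special i X" "X \<subseteq># N" | i X where "special i X" "X \<subseteq># M"
    | "\<And>i X. special i X \<Longrightarrow> \<not> X \<subseteq># M" "\<And>i X. special i X \<Longrightarrow> \<not> X \<subseteq># N"
    by blast
  then show ?thesis
  proof cases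
    case 1
    from special_share(2)[OF fib ne zf this] show ?thesis .
  next
    case 2
    from special_share(2)[OF fib' ne' zfM this] show ?thesis by (rule share_sym)
  next
    case 3
    show ?thesis
      by (rule coherent_share[OF nonspecial_coherent[OF zfM MV 3(1)] nonspecial_coherent[OF zf NV 3(2)] fib ne])
  qed
qed

theorem roots_conn:
  assumes "same_fiber V M N"
  shows "conn V M N"
proof (rule conn_if_share[OF _ assms])
  fix M N
  assume fib: "same_fiber V M N" and ne: "M \<noteq> {#}"
  then have fib': "same_fiber V N M" and ne': "N \<noteq> {#}" by (auto simp: same_fiber_def)
  consider "\<not> reaches_zero N" | "\<not> reaches_zero M" | "reaches_zero M" "reaches_zero N" by blast
  then show "share V M N"
  proof cases
    case 1
    then show ?thesis by (rule roots_share_zero_free[OF fib ne])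
  next
    case 2
    then show ?thesis using roots_share_zero_free[OF fib' ne'] share_sym by blast
  next
    case 3
    then show ?thesis unfolding reaches_zero_def share_def by blast
  qed
qed

end

section \<open>Irreducible quadratic binomials\<close>

text \<open>The absence of zero divisors is inherited from the type of all polynomials.\<close>

lemma domain_mpoly_ring: "domain (mpoly_ring n :: 'k::field mpoly ring)"
proof -
  interpret cring "mpoly_ring n :: 'k mpoly ring" by (rule cring_mpoly_ring)
  show ?thesis by unfold_locales (simp_all add: mpoly_ring_def)
qed

text \<open>The top-weight parts of the factors have a nonzero product, and the remaining products
  have strictly smaller weight, so they cannot cancel it.\<close>

lemma keys_mult_top:
  fixes g h :: "'k::field mpoly" and W :: "(nat \<Rightarrow>\<^sub>0 nat) \<Rightarrow> int"
  assumes W: "\<And>u v. W (u + v) = W u + W v" and "g \<noteq> 0" "h \<noteq> 0"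
  shows "\<exists>w\<in>Poly_Mapping.keys (g * h). W w = Max (W ` Poly_Mapping.keys g) + Max (W ` Poly_Mapping.keys h)"
proof -
  have split: "\<exists>t r. p = t + r \<and> t \<noteq> 0 \<and> (\<forall>u\<in>Poly_Mapping.keys t. W u = m) \<and>
      (\<forall>u\<in>Poly_Mapping.keys r. W u < m)"
    if "p \<noteq> 0" and m: "m = Max (W ` Poly_Mapping.keys p)" for p :: "'k mpoly" and m
  proof -
    let ?part = "\<lambda>U. \<Sum>u\<in>U. Poly_Mapping.single u (Poly_Mapping.lookup p u)"
    let ?T = "{u \<in> Poly_Mapping.keys p. W u = m}"
    let ?R = "{u \<in> Poly_Mapping.keys p. W u \<noteq> m}"
    have keys: "Poly_Mapping.keys (?part U) = U" if "U \<subseteq> Poly_Mapping.keys p" for U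
    proof -
      have "finite U" using that by (rule finite_subset) simp
      then show ?thesis
        using that by (auto simp: in_keys_iff lookup_sum lookup_single when_def sum.delta' in_mono split: if_splits)
    qed
    have "p = ?part (?T \<union> ?R)"
      by (subst mpoly_as_sum[of p]) (rule sum.cong, auto)
    also have "\<dots> = ?part ?T + ?part ?R"
      by (rule sum.union_disjoint) auto
    finally have "p = ?part ?T + ?part ?R" .
    moreover have ne: "W ` Poly_Mapping.keys p \<noteq> {}" using that(1) by simp
    then have "m \<in> W ` Poly_Mapping.keys p" unfolding m by (intro Max_in) auto
    then have "?T \<noteq> {}" by auto
    then have "?part ?T \<noteq> 0" using keys[of ?T] by fastforce
    moreover have "W u < m" if "u \<in> ?R" for u
      using that Max_ge[of "W ` Poly_Mapping.keys p" "W u"] by (auto simp: m order_less_le)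
    ultimately show ?thesis
      by (intro exI[of _ "?part ?T"] exI[of _ "?part ?R"]) (auto simp: keys)
  qed
  define a where "a = Max (W ` Poly_Mapping.keys g)"
  define b where "b = Max (W ` Poly_Mapping.keys h)"
  obtain g1 g2 where g: "g = g1 + g2" "g1 \<noteq> 0" "\<forall>u\<in>Poly_Mapping.keys g1. W u = a"
      "\<forall>u\<in>Poly_Mapping.keys g2. W u < a"
    using split[OF assms(2) a_def] by blast
  obtain h1 h2 where h: "h = h1 + h2" "h1 \<noteq> 0" "\<forall>u\<in>Poly_Mapping.keys h1. W u = b"
      "\<forall>u\<in>Poly_Mapping.keys h2. W u < b"
    using split[OF assms(3) b_def] by blast
  have "g1 * h1 \<noteq> 0" using g(2) h(2) by simp
  then obtain w where w: "w \<in> Poly_Mapping.keys (g1 * h1)" by fastforce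
  have Ww: "W w = a + b" using w keys_mult[of g1 h1] g(3) h(3) by (auto simp: W)
  have "Poly_Mapping.lookup (g1 * h2) w = 0"
    using keys_mult[of g1 h2] g(3) h(4) Ww by (fastforce simp: W not_in_keys_iff_lookup_eq_zero[symmetric])
  moreover have "Poly_Mapping.lookup (g2 * h1) w = 0"
    using keys_mult[of g2 h1] g(4) h(3) Ww by (fastforce simp: W not_in_keys_iff_lookup_eq_zero[symmetric])
  moreover have "Poly_Mapping.lookup (g2 * h2) w = 0"
    using keys_mult[of g2 h2] g(4) h(4) Ww by (fastforce simp: W not_in_keys_iff_lookup_eq_zero[symmetric])
  ultimately have "Poly_Mapping.lookup (g * h) w = Poly_Mapping.lookup (g1 * h1) w"
    by (simp add: g(1) h(1) algebra_simps lookup_add)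
  then have "w \<in> Poly_Mapping.keys (g * h)" using w by (simp add: in_keys_iff)
  then show ?thesis using Ww by (auto simp: a_def b_def)
qed

text \<open>The maxima of \<open>W\<close> and of \<open>- W\<close> are both additive under
  multiplication. So the spread of the weights in the product, which is 0, is the sum of the spreads
  in the factors.\<close>

lemma factors_homogeneous:
  fixes g h :: "'k::field mpoly" and W :: "(nat \<Rightarrow>\<^sub>0 nat) \<Rightarrow> int"
  assumes W: "\<And>u v. W (u + v) = W u + W v" and nz: "g \<noteq> 0" "h \<noteq> 0"
    and hom: "\<And>w. w \<in> Poly_Mapping.keys (g * h) \<Longrightarrow> W w = c"
  obtains a b where "a + b = c" "\<forall>u\<in>Poly_Mapping.keys g. W u = a"
    "\<forall>u\<in>Poly_Mapping.keys h. W u = b"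
proof -
  let ?M = "\<lambda>W p. Max (W ` Poly_Mapping.keys (p :: 'k mpoly)) :: int"
  let ?W' = "\<lambda>u. - W u"
  have 1: "?M W g + ?M W h = c" using keys_mult_top[of W, OF W nz] hom by auto
  have 2: "?M ?W' g + ?M ?W' h = - c" using keys_mult_top[of ?W', OF _ nz] hom W by fastforce
  have le: "W u \<le> ?M W p" "- W u \<le> ?M ?W' p" if "u \<in> Poly_Mapping.keys p" for u p
    using that by (auto intro!: Max_ge)
  obtain u v where uv: "u \<in> Poly_Mapping.keys g" "v \<in> Poly_Mapping.keys h"
    using nz by (metis equals0I keys_eq_empty)
  note 3 = le[OF uv(1)] le[OF uv(2)]
  have "W x = ?M W g" if "x \<in> Poly_Mapping.keys g" for x
    using le[OF that] 1 2 3 by linarith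
  moreover have "W x = ?M W h" if "x \<in> Poly_Mapping.keys h" for x
    using le[OF that] 1 2 3 by linarith
  ultimately show ?thesis using 1 that by blast
qed

definition linear_weight :: "nat \<Rightarrow> (nat \<Rightarrow> int) \<Rightarrow> (nat \<Rightarrow>\<^sub>0 nat) \<Rightarrow> int" where
  "linear_weight n s u = (\<Sum>t<n. s t * int (Poly_Mapping.lookup u t))"

lemma linear_weight_add: "linear_weight n s (u + v) = linear_weight n s u + linear_weight n s v"
  by (simp add: linear_weight_def lookup_add algebra_simps sum.distrib)

lemma linear_weight_single: "t < n \<Longrightarrow> linear_weight n s (Poly_Mapping.single t 1) = s t"
  by (simp add: linear_weight_def lookup_single when_def if_distrib[of "(*) _"] if_distrib[of int] cong: if_cong)

lemma degree_zero_monomial: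
  assumes "linear_weight n (\<lambda>_. 1) u = 0" "Poly_Mapping.keys u \<subseteq> {..<n}"
  shows "u = 0"
proof (rule poly_mapping_eqI)
  fix t
  have "\<forall>t\<in>{..<n}. int (Poly_Mapping.lookup u t) = 0"
    using assms(1) unfolding linear_weight_def by (subst (asm) sum_nonneg_eq_0_iff) auto
  then show "Poly_Mapping.lookup u t = Poly_Mapping.lookup 0 t"
    using assms(2) by (cases "t < n") (auto simp: in_keys_iff subset_iff)
qed

lemma degree_one_monomial:
  assumes "linear_weight n (\<lambda>_. 1) u = 1" "Poly_Mapping.keys u \<subseteq> {..<n}"
  obtains t where "t < n" "u = Poly_Mapping.single t 1"
proof -
  have "(\<Sum>t<n. Poly_Mapping.lookup u t) = 1"
    using assms(1) by (simp add: linear_weight_def flip: of_nat_sum)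
  then obtain t where t: "t \<in> {..<n}" "Poly_Mapping.lookup u t = 1"
      "\<forall>y\<in>{..<n}. t \<noteq> y \<longrightarrow> Poly_Mapping.lookup u y = 0"
    using sum_eq_1_iff[of "{..<n}" "Poly_Mapping.lookup u"] by auto
  have "u = Poly_Mapping.single t 1"
  proof (rule poly_mapping_eqI)
    fix y show "Poly_Mapping.lookup u y = Poly_Mapping.lookup (Poly_Mapping.single t 1) y"
      using t assms(2) by (cases "y < n") (auto simp: lookup_single when_def in_keys_iff subset_iff)
  qed
  then show ?thesis using that t by simp
qed

text \<open>Values below 4 are reserved for the given indices and satisfy
  \<open>2 + 2 = 1 + 3\<close> or \<open>0 + 3 = 1 + 2\<close>; the shift by 4 keeps all other
  indices away from them.\<close>

lemma separating_weight:
  fixes i j k l :: nat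
  assumes "{i, j} \<inter> {k, l} = {}" "i \<noteq> j \<or> k \<noteq> l"
  obtains s :: "nat \<Rightarrow> int" where "inj s" "s i + s j = s k + s l"
proof -
  let ?b = "\<lambda>t. int t + 4"
  have inj: "inj (f(x := y))" if "inj f" "\<And>t. f t \<noteq> y" for f :: "nat \<Rightarrow> int" and x y
    using that by (intro inj_on_fun_updI) auto
  have b: "inj ?b" by (simp add: inj_def)
  consider "i = j" "k \<noteq> l" | "k = l" "i \<noteq> j" | "i \<noteq> j" "k \<noteq> l" using assms(2) by blast
  then show ?thesis
  proof cases
    case 1
    show ?thesis
      by (rule that[of "?b(i := 2, k := 1, l := 3)"], intro inj b) (use 1 assms(1) in auto)
  next
    case 2
    show ?thesis
      by (rule that[of "?b(k := 2, i := 1, j := 3)"], intro inj b) (use 2 assms(1) in auto)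
  next
    case 3
    show ?thesis
      by (rule that[of "?b(i := 0, j := 3, k := 1, l := 2)"], intro inj b) (use 3 assms(1) in auto)
  qed
qed

lemma const_unit:
  assumes "c \<noteq> 0"
  shows "Poly_Mapping.single 0 c \<in> Units (mpoly_ring n :: 'k::field mpoly ring)"
proof -
  have "Poly_Mapping.single 0 (inverse c) * Poly_Mapping.single 0 c = (1 :: 'k mpoly)"
    "Poly_Mapping.single 0 c * Poly_Mapping.single 0 (inverse c) = (1 :: 'k mpoly)"
    using assms by (simp_all add: mult_single)
  then show ?thesis unfolding Units_def
    by (auto simp: mpoly_ring_def intro!: exI[of _ "Poly_Mapping.single 0 (inverse c)"])
qed

abbreviation quad :: "nat \<Rightarrow> nat \<Rightarrow> nat \<Rightarrow>\<^sub>0 nat" where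
  "quad i j \<equiv> Poly_Mapping.single i 1 + Poly_Mapping.single j 1"

text \<open>
  A weight that separates the variables forces two linear factors of a homogeneous
  binomial to be monomials.
\<close>

lemma quadratic_binomial_irreducible:
  assumes lt: "i < n" "j < n" "k < n" "l < n"
    and dis: "{i, j} \<inter> {k, l} = {}" "i \<noteq> j \<or> k \<noteq> l"
  shows "ring_irreducible\<^bsub>mpoly_ring n\<^esub> (monomial (quad i j) - monomial (quad k l) :: 'k::field mpoly)"
proof -
  interpret domain "mpoly_ring n :: 'k mpoly ring" by (rule domain_mpoly_ring)
  let ?f = "monomial (quad i j) - monomial (quad k l) :: 'k mpoly"
  let ?deg = "linear_weight n (\<lambda>_. 1)"
  have ne: "quad i j \<noteq> quad k l"
  proof
    assume "quad i j = quad k l"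
    then have "Poly_Mapping.lookup (quad i j) i = Poly_Mapping.lookup (quad k l) i" by simp
    then show False using dis by (auto simp: lookup_add lookup_single when_def split: if_splits)
  qed
  have keys: "Poly_Mapping.keys ?f = {quad i j, quad k l}" by (rule keys_binomial[OF ne])
  then have f0: "?f \<noteq> 0" by fastforce
  have deg_f: "?deg w = 2" if "w \<in> Poly_Mapping.keys ?f" for w
    using that lt by (auto simp: keys linear_weight_add linear_weight_single simp del: One_nat_def)
  have deg_nonneg: "0 \<le> ?deg u" for u by (simp add: linear_weight_def sum_nonneg)
  have carrier: "p \<in> carrier (mpoly_ring n) \<longleftrightarrow> (\<forall>u\<in>Poly_Mapping.keys p. Poly_Mapping.keys u \<subseteq> {..<n})"
    for p :: "'k mpoly" by (simp add: mpoly_ring_def)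
  have q: "Poly_Mapping.keys (quad a b) \<subseteq> {..<n}" if "a < n" "b < n" for a b
    by (rule subset_trans[OF Poly_Mapping.keys_add]) (use that in \<open>simp del: One_nat_def\<close>)
  have fc: "?f \<in> carrier (mpoly_ring n)" unfolding carrier keys using lt q by blast
  have const: "p \<in> Units (mpoly_ring n)"
    if p: "p \<in> carrier (mpoly_ring n)" "p \<noteq> 0" "\<And>u. u \<in> Poly_Mapping.keys p \<Longrightarrow> ?deg u = 0" for p :: "'k mpoly"
  proof -
    have "Poly_Mapping.keys p \<subseteq> {0}"
      using degree_zero_monomial[of n] p(1,3) unfolding carrier by blast
    moreover have "Poly_Mapping.keys p \<noteq> {}" using p(2) by simp
    ultimately have kp: "Poly_Mapping.keys p = {0}" by blast
    obtain c where c: "c = Poly_Mapping.lookup p 0" by blast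
    have "p = Poly_Mapping.single 0 c"
    proof (rule poly_mapping_eqI)
      fix u show "Poly_Mapping.lookup p u = Poly_Mapping.lookup (Poly_Mapping.single 0 c) u"
        using kp c by (cases "u = 0") (auto simp: lookup_single not_in_keys_iff_lookup_eq_zero[symmetric])
    qed
    moreover have "c \<noteq> 0" using kp c by (simp flip: in_keys_iff)
    ultimately show ?thesis using const_unit[of c n] by simp
  qed
  show ?thesis
  proof (rule ring_irreducibleI)
    show "?f \<in> carrier (mpoly_ring n) - {\<zero>\<^bsub>mpoly_ring n\<^esub>}" using fc f0 by (simp add: mpoly_ring_def)
  next
    show "?f \<notin> Units (mpoly_ring n)"
    proof
      assume "?f \<in> Units (mpoly_ring n)"
      then obtain g where g: "?f * g = 1" by (auto simp: Units_def mpoly_ring_def)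
      then have g0: "g \<noteq> 0" by auto
      have hom: "?deg w = 0" if "w \<in> Poly_Mapping.keys (?f * g)" for w
        using that g by (simp add: linear_weight_def)
      show False
      proof (rule factors_homogeneous[where W = ?deg, OF linear_weight_add f0 g0 hom])
        fix a b :: int
        assume ab: "a + b = 0" "\<forall>u\<in>Poly_Mapping.keys ?f. ?deg u = a"
          "\<forall>u\<in>Poly_Mapping.keys g. ?deg u = b"
        obtain v where "v \<in> Poly_Mapping.keys g" using g0 by (metis equals0I keys_eq_empty)
        then have "0 \<le> b" using ab(3) deg_nonneg by metis
        moreover have "a = 2" using ab(2) deg_f[of "quad i j"] keys by simp
        ultimately show False using ab(1) by simp
      qed
    qed
  next
    fix g h :: "'k mpoly"
    assume gh: "g \<in> carrier (mpoly_ring n)" "h \<in> carrier (mpoly_ring n)"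
      and "?f = g \<otimes>\<^bsub>mpoly_ring n\<^esub> h"
    then have f: "?f = g * h" by (simp add: mpoly_ring_def)
    then have nz: "g \<noteq> 0" "h \<noteq> 0" using f0 by auto
    obtain a b where ab: "a + b = 2" "\<forall>u\<in>Poly_Mapping.keys g. ?deg u = a"
        "\<forall>u\<in>Poly_Mapping.keys h. ?deg u = b"
      by (rule factors_homogeneous[where W = ?deg, OF linear_weight_add nz deg_f[unfolded f]])
    obtain u v where uv: "u \<in> Poly_Mapping.keys g" "v \<in> Poly_Mapping.keys h"
      using nz by (metis equals0I keys_eq_empty)
    have "0 \<le> a" "0 \<le> b" using bspec[OF ab(2) uv(1)] bspec[OF ab(3) uv(2)] deg_nonneg by metis+
    then consider "a = 0" | "b = 0" | "a = 1" "b = 1" using ab(1) by linarith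
    then show "g \<in> Units (mpoly_ring n) \<or> h \<in> Units (mpoly_ring n)"
    proof cases
      case 3
      obtain s :: "nat \<Rightarrow> int" where s: "inj s" "s i + s j = s k + s l" by (rule separating_weight[OF dis])
      have hom: "linear_weight n s w = s i + s j" if "w \<in> Poly_Mapping.keys (g * h)" for w
        using that lt s(2) keys f by (auto simp: linear_weight_add linear_weight_single simp del: One_nat_def)
      obtain a' b' where "a' + b' = s i + s j"
          and ab': "\<forall>u\<in>Poly_Mapping.keys g. linear_weight n s u = a'"
          "\<forall>u\<in>Poly_Mapping.keys h. linear_weight n s u = b'"
        by (rule factors_homogeneous[where W = "linear_weight n s", OF linear_weight_add nz hom])
      \<comment> \<open>The monomials of a linear factor are variables of equal
        \<open>s\<close>-weight, and \<open>s\<close> is injective, so there is only one. A product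
        of two such factors has a single term, unlike the binomial.\<close>
      have unique: "x = y" if p: "p \<in> carrier (mpoly_ring n)" "\<And>u. u \<in> Poly_Mapping.keys p \<Longrightarrow> ?deg u = 1"
          "\<And>u. u \<in> Poly_Mapping.keys p \<Longrightarrow> linear_weight n s u = c"
          and xy: "x \<in> Poly_Mapping.keys p" "y \<in> Poly_Mapping.keys p" for p :: "'k mpoly" and x y c
      proof -
        obtain t where t: "t < n" "x = Poly_Mapping.single t 1"
          using degree_one_monomial[of n x] p(1,2) xy(1) by (auto simp: carrier)
        obtain t' where t': "t' < n" "y = Poly_Mapping.single t' 1"
          using degree_one_monomial[of n y] p(1,2) xy(2) by (auto simp: carrier)
        have "s t = s t'"
          using p(3)[OF xy(1)] p(3)[OF xy(2)] t t' by (simp add: linear_weight_single del: One_nat_def)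
        then show ?thesis using s(1) t t' by (simp add: inj_eq)
      qed
      have "Poly_Mapping.keys g \<subseteq> {u}" using unique[OF gh(1) _ _ _ uv(1), of a'] ab(2) ab'(1) 3 by blast
      moreover have "Poly_Mapping.keys h \<subseteq> {v}" using unique[OF gh(2) _ _ _ uv(2), of b'] ab(3) ab'(2) 3 by blast
      ultimately have "Poly_Mapping.keys (g * h) \<subseteq> {u + v}" using keys_mult[of g h] by blast
      then have "quad i j = u + v" "quad k l = u + v" using keys f by auto
      then show ?thesis using ne by simp
    qed (use ab const gh nz in auto)
  qed
qed

section \<open>Toric ideals and binomials\<close>

text \<open>Monomials as multisets of variable indices. The correspondence is bijective, which lets
  moves on multisets act on monomials.\<close>

definition expo :: "nat multiset \<Rightarrow> nat \<Rightarrow>\<^sub>0 nat" where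
  "expo M = (\<Sum>j\<in>#M. Poly_Mapping.single j 1)"

lemma expo_simps: "expo {#} = 0" "expo (M + N) = expo M + expo N"
  "expo (add_mset j M) = Poly_Mapping.single j 1 + expo M"
  by (simp_all add: expo_def)

lemma lookup_expo: "Poly_Mapping.lookup (expo M) j = count M j"
  by (induction M) (auto simp: expo_simps lookup_add lookup_single when_def)

lemma keys_expo: "Poly_Mapping.keys (expo M) = set_mset M"
  by (auto simp: in_keys_iff lookup_expo)

lemma expo_inject: "expo M = expo N \<longleftrightarrow> M = N"
  by (metis lookup_expo multiset_eq_iff)

lemma expo_cases: obtains M where "u = expo M"
proof -
  have "finite {j. 0 < Poly_Mapping.lookup u j}" using finite_lookup[of u] by simp
  then have "count (Abs_multiset (Poly_Mapping.lookup u)) = Poly_Mapping.lookup u"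
    by (rule count_Abs_multiset)
  then show ?thesis
    by (intro that[of "Abs_multiset (Poly_Mapping.lookup u)"] poly_mapping_eqI) (simp add: lookup_expo)
qed

lemma mon_degree_expo: "mon_degree (expo M) = size M"
  by (simp add: mon_degree_def keys_expo lookup_expo size_multiset_overloaded_eq)

text \<open>The exponent of the Laurent monomial that is the image of \<open>expo M\<close>.\<close>

definition col_sum :: "int mat \<Rightarrow> nat multiset \<Rightarrow> (nat \<Rightarrow>\<^sub>0 int)" where
  "col_sum A M = (\<Sum>j\<in>#M. \<Sum>i<dim_row A. Poly_Mapping.single i (A $$ (i, j)))"

lemma toric_map_expo: "toric_map A (Poly_Mapping.single (expo M) c) = Poly_Mapping.single (col_sum A M) (c :: 'k::field)"
proof -
  have "toric_map A (monomial (expo M)) = (Poly_Mapping.single (col_sum A M) 1 :: 'k laurent)"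
  proof (induction M)
    case empty
    show ?case using toric_map_const[of A 1] by (simp add: expo_simps col_sum_def)
  next
    case (add j M)
    have "monomial (expo (add_mset j M)) =
        monomial (Poly_Mapping.single j 1) * (monomial (expo M) :: 'k mpoly)"
      by (simp add: expo_simps mult_single)
    then show ?case
      by (simp only: toric_map_mult toric_map_var add.IH)
        (simp add: column_power_def col_sum_def mult_single)
  qed
  moreover have "Poly_Mapping.single (expo M) c = Poly_Mapping.single 0 c * (monomial (expo M) :: 'k mpoly)"
    by (simp add: mult_single)
  ultimately have "toric_map A (Poly_Mapping.single (expo M) c) =
      Poly_Mapping.single 0 c * Poly_Mapping.single (col_sum A M) 1"
    by (simp only: toric_map_mult toric_map_const)
  then show ?thesis by (simp add: mult_single)
qed

lemma toric_map_diff: "toric_map A (p - q) = toric_map A p - toric_map A (q :: 'k::field mpoly)"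
  using toric_map_add[of A "p - q" q] by (simp add: eq_diff_eq)

lemma mem_toric_ideal:
  "(f :: 'k::field mpoly) \<in> toric_ideal A \<longleftrightarrow> f \<in> carrier (mpoly_ring (dim_col A)) \<and> toric_map A f = 0"
  unfolding toric_ideal_def a_kernel_def' by (auto simp: laurent_ring_def)

lemma binomial_mem_toric_ideal:
  assumes "M \<noteq> N"
  shows "(monomial (expo M) - monomial (expo N) :: 'k::field mpoly) \<in> toric_ideal A \<longleftrightarrow>
    set_mset M \<subseteq> {..<dim_col A} \<and> set_mset N \<subseteq> {..<dim_col A} \<and> col_sum A M = col_sum A N"
proof -
  have ne: "expo M \<noteq> expo N" using assms by (simp add: expo_inject)
  have "(Poly_Mapping.single x 1 - Poly_Mapping.single y 1 :: 'k laurent) = 0 \<longleftrightarrow> x = y" for x y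
  proof
    assume "(Poly_Mapping.single x 1 - Poly_Mapping.single y 1 :: 'k laurent) = 0"
    then have "Poly_Mapping.keys (Poly_Mapping.single x 1 :: 'k laurent) =
        Poly_Mapping.keys (Poly_Mapping.single y 1 :: 'k laurent)" by simp
    then show "x = y" by (simp only: keys_single) simp
  qed simp
  then show ?thesis
    by (auto simp: mem_toric_ideal toric_map_diff toric_map_expo mpoly_ring_def
        keys_binomial[OF ne] keys_expo)
qed

lemma ideal_toric_ideal: "ideal (toric_ideal A :: 'k::field mpoly set) (mpoly_ring (dim_col A))"
proof -
  interpret ring_hom_ring "mpoly_ring (dim_col A) :: 'k mpoly ring" "laurent_ring (dim_row A)" "toric_map A"
    by (intro ring_hom_ringI2 cring.axioms(1) cring_mpoly_ring cring_laurent_ring toric_map_ring_hom)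
  show ?thesis unfolding toric_ideal_def by (rule kernel_is_ideal)
qed

lemma ideal_mpoly_ring_closed:
  assumes "ideal J (mpoly_ring n :: 'k::field mpoly ring)"
  shows "0 \<in> J" "p \<in> J \<Longrightarrow> q \<in> J \<Longrightarrow> p + q \<in> J"
    "p \<in> J \<Longrightarrow> q \<in> carrier (mpoly_ring n) \<Longrightarrow> p * q \<in> J"
    "(\<And>i. i \<in> I \<Longrightarrow> h i \<in> J) \<Longrightarrow> (\<Sum>i\<in>I. h i) \<in> J"
proof -
  interpret ideal J "mpoly_ring n :: 'k mpoly ring" by fact
  show zero: "0 \<in> J" using additive_subgroup.zero_closed[OF is_additive_subgroup] by (simp add: mpoly_ring_def)
  show add: "p \<in> J \<Longrightarrow> q \<in> J \<Longrightarrow> p + q \<in> J" for p q using additive_subgroup.a_closed[OF is_additive_subgroup, of p q] by (simp add: mpoly_ring_def)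
  show "p \<in> J \<Longrightarrow> q \<in> carrier (mpoly_ring n) \<Longrightarrow> p * q \<in> J"
    using I_r_closed[of p q] by (simp add: mpoly_ring_def)
  show "(\<And>i. i \<in> I \<Longrightarrow> h i \<in> J) \<Longrightarrow> (\<Sum>i\<in>I. h i) \<in> J"
    by (induction I rule: infinite_finite_induct) (auto intro: zero add)
qed

text \<open>
  Replacing every monomial by a fixed representative of its degree turns an element of the
  kernel into zero, so the element is a combination of binomials.
\<close>

lemma toric_ideal_subset:
  fixes J :: "'k::field mpoly set"
  assumes J: "ideal J (mpoly_ring (dim_col A))"
    and bin: "\<And>M N. set_mset M \<subseteq> {..<dim_col A} \<Longrightarrow> set_mset N \<subseteq> {..<dim_col A} \<Longrightarrow>
      col_sum A M = col_sum A N \<Longrightarrow> monomial (expo M) - monomial (expo N) \<in> J"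
  shows "toric_ideal A \<subseteq> J"
proof
  fix f :: "'k mpoly" assume "f \<in> toric_ideal A"
  then have fc: "\<And>u. u \<in> Poly_Mapping.keys f \<Longrightarrow> Poly_Mapping.keys u \<subseteq> {..<dim_col A}"
    and f0: "toric_map A f = 0"
    by (auto simp: mem_toric_ideal mpoly_ring_def)
  let ?K = "Poly_Mapping.keys f"
  define m where "m u = (SOME M. u = expo M)" for u
  have m: "expo (m u) = u" for u
    unfolding m_def by (rule someI2_ex) (metis expo_cases, simp)
  define D where "D u = col_sum A (m u)" for u
  define r where "r w = (SOME u. u \<in> ?K \<and> D u = w)" for w
  have r: "r (D u) \<in> ?K" "D (r (D u)) = D u" if "u \<in> ?K" for u
    using someI[of "\<lambda>v. v \<in> ?K \<and> D v = D u" u] that by (auto simp: r_def)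
  have "toric_map A f = (\<Sum>u\<in>?K. toric_map A (Poly_Mapping.single u (Poly_Mapping.lookup f u)))"
    by (subst mpoly_as_sum[of f]) (rule toric_map_sum)
  also have "\<dots> = (\<Sum>u\<in>?K. Poly_Mapping.single (D u) (Poly_Mapping.lookup f u))"
  proof (rule sum.cong[OF refl])
    fix u
    show "toric_map A (Poly_Mapping.single u (Poly_Mapping.lookup f u)) =
        Poly_Mapping.single (D u) (Poly_Mapping.lookup f u)"
      using toric_map_expo[of A "m u" "Poly_Mapping.lookup f u"] by (simp add: m D_def)
  qed
  finally have zero: "(\<Sum>u\<in>?K. Poly_Mapping.single (D u) (Poly_Mapping.lookup f u)) = 0"
    using f0 by simp
  \<comment> \<open>Coefficient comparison at one Laurent monomial \<open>w\<close>: only the terms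
    of \<open>f\<close> that are sent to \<open>w\<close> contribute.\<close>
  have coeff: "(\<Sum>u\<in>{u\<in>?K. D u = w}. Poly_Mapping.lookup f u) = 0" for w
  proof -
    have "0 = Poly_Mapping.lookup (\<Sum>u\<in>?K. Poly_Mapping.single (D u) (Poly_Mapping.lookup f u)) w"
      by (simp add: zero)
    also have "\<dots> = (\<Sum>u\<in>?K. if D u = w then Poly_Mapping.lookup f u else 0)"
      by (simp add: lookup_sum lookup_single when_def)
    also have "\<dots> = (\<Sum>u\<in>{u\<in>?K. D u = w}. Poly_Mapping.lookup f u)"
      by (rule sum.inter_filter[symmetric]) simp
    finally show ?thesis by simp
  qed
  have single_sum: "(\<Sum>u\<in>U. Poly_Mapping.single x (g u)) = Poly_Mapping.single x (\<Sum>u\<in>U. g u)"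
    for U x and g :: "(nat \<Rightarrow>\<^sub>0 nat) \<Rightarrow> 'k"
    by (induction U rule: infinite_finite_induct) (simp_all add: single_add)
  have "(\<Sum>u\<in>?K. Poly_Mapping.single (r (D u)) (Poly_Mapping.lookup f u)) =
      (\<Sum>w\<in>D ` ?K. \<Sum>u\<in>{u\<in>?K. D u = w}. Poly_Mapping.single (r (D u)) (Poly_Mapping.lookup f u))"
    by (rule sum.image_gen) simp
  also have "\<dots> = (\<Sum>w\<in>D ` ?K. Poly_Mapping.single (r w) (\<Sum>u\<in>{u\<in>?K. D u = w}. Poly_Mapping.lookup f u))"
    by (simp flip: single_sum)
  also have "\<dots> = 0" by (simp add: coeff)
  finally have reps: "(\<Sum>u\<in>?K. Poly_Mapping.single (r (D u)) (Poly_Mapping.lookup f u)) = 0" .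
  have "f = (\<Sum>u\<in>?K. Poly_Mapping.single u (Poly_Mapping.lookup f u)) -
      (\<Sum>u\<in>?K. Poly_Mapping.single (r (D u)) (Poly_Mapping.lookup f u))"
    using mpoly_as_sum[of f] reps by simp
  also have "\<dots> = (\<Sum>u\<in>?K. (monomial u - monomial (r (D u))) * Poly_Mapping.single 0 (Poly_Mapping.lookup f u))"
    by (simp add: sum_subtractf[symmetric] left_diff_distrib mult_single)
  also have "\<dots> \<in> J"
  proof (intro ideal_mpoly_ring_closed(3,4)[OF J])
    fix u assume u: "u \<in> ?K"
    have "monomial (expo (m u)) - monomial (expo (m (r (D u)))) \<in> J"
      using fc[OF u] fc[OF r(1)[OF u]] r(2)[OF u]
      by (intro bin) (auto simp: D_def m keys_expo[symmetric])
    then show "monomial u - monomial (r (D u)) \<in> J" by (simp add: m)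
  qed (simp add: mpoly_ring_def)
  finally show "f \<in> J" .
qed

section \<open>Quadratic binomials are circuits\<close>

context root_config
begin

definition total :: "(nat \<Rightarrow>\<^sub>0 int) \<Rightarrow> int" where
  "total x = (\<Sum>r<d. Poly_Mapping.lookup x r)"

lemma total_simps:
  "total 0 = 0" "total (x + y) = total x + total y" "total (x - y) = total x - total y"
  "i < d \<Longrightarrow> total (e i) = 1"
  by (simp_all add: total_def lookup_add lookup_minus lookup_e sum.distrib sum_subtractf)

lemma root_total:
  assumes "x \<in> V"
  obtains "total x = 0" "Poly_Mapping.lookup x r \<in> {-1, 0, 1}"
  | "total x = 1" "Poly_Mapping.lookup x r \<in> {0, 1, 2}"
  | "total x = 2" "Poly_Mapping.lookup x r \<in> {0, 1, 2}"
  using assms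
  by (cases rule: root_cases) (use that in \<open>auto simp: total_simps lookup_add lookup_minus lookup_e split: if_splits\<close>)

text \<open>
  Four distinct collinear roots would have the same coordinate sum, and then every
  coordinate takes at most three values on them.
\<close>

lemma roots_affinely_independent:
  assumes V: "a \<in> V" "b \<in> V" "x \<in> V" "y \<in> V"
    and ne: "a \<noteq> b" "a \<noteq> x" "a \<noteq> y" "x \<noteq> y"
    and par: "a + b = x + y"
    and c: "\<And>r. c1 * Poly_Mapping.lookup a r + c2 * Poly_Mapping.lookup x r + c3 * Poly_Mapping.lookup y r = 0"
    and c0: "c1 + c2 + c3 = 0"
  shows "c1 = 0 \<and> c2 = 0 \<and> c3 = 0"
proof (rule ccontr)
  \<comment> \<open>A nontrivial relation makes \<open>a\<close>, \<open>x\<close>, \<open>y\<close>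
    collinear, and \<open>b = x + y - a\<close> then lies on the same line.\<close>
  assume nz: "\<not> ?thesis"
  have c3: "c3 = - c1 - c2" using c0 by simp
  have rel: "c1 * (Poly_Mapping.lookup a r - Poly_Mapping.lookup y r) +
      c2 * (Poly_Mapping.lookup x r - Poly_Mapping.lookup y r) = 0" for r
    using c[of r] by (simp add: c3 algebra_simps)
  have b: "Poly_Mapping.lookup b r = Poly_Mapping.lookup x r + Poly_Mapping.lookup y r - Poly_Mapping.lookup a r" for r
    using arg_cong[OF par, of "\<lambda>z. Poly_Mapping.lookup z r"] by (simp add: lookup_add)
  have c1: "c1 \<noteq> 0"
  proof
    assume "c1 = 0"
    then have "c2 \<noteq> 0" using nz c3 by auto
    then have "x = y" using rel \<open>c1 = 0\<close> by (intro poly_mapping_eqI) simp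
    then show False using ne by simp
  qed
  have c2: "c2 \<noteq> 0"
  proof
    assume "c2 = 0"
    then have "a = y" using rel c1 by (intro poly_mapping_eqI) simp
    then show False using ne by simp
  qed
  have c12: "c1 + c2 \<noteq> 0"
  proof
    assume "c1 + c2 = 0"
    then have "c2 = - c1" by simp
    then have "c1 * (Poly_Mapping.lookup a r - Poly_Mapping.lookup x r) = 0" for r
      using rel[of r] by (simp add: algebra_simps)
    then have "a = x" using c1 by (intro poly_mapping_eqI) simp
    then show False using ne by simp
  qed
  have c122: "c1 + 2 * c2 \<noteq> 0"
  proof
    assume "c1 + 2 * c2 = 0"
    then have "c1 = - 2 * c2" by simp
    then have "c2 * (Poly_Mapping.lookup b r - Poly_Mapping.lookup a r) = 0" for r
      using rel[of r] by (simp add: algebra_simps b)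
    then have "a = b" using c2 by (intro poly_mapping_eqI) simp
    then show False using ne by simp
  qed
  \<comment> \<open>The inequalities for \<open>c1\<close> and \<open>c2\<close> express that the
    four points differ. Hence a functional that obeys the relation and separates \<open>a\<close>
    from \<open>y\<close> takes four different values; this is applied to the coordinate sum and
    then to a coordinate.\<close>
  have distinct: "distinct [A, X, Y, X + Y - A]"
    if "c1 * (A - Y) + c2 * (X - Y) = 0" "A \<noteq> Y" for A X Y :: int
  proof -
    have "X \<noteq> Y" using that c1 by auto
    moreover have "A \<noteq> X"
    proof
      assume "A = X"
      then have "(c1 + c2) * (A - Y) = 0" using that(1) by (simp add: algebra_simps)
      then show False using that(2) c12 by simp
    qed
    moreover have "A \<noteq> X + Y - A"
    proof
      assume "A = X + Y - A"
      then have X: "X = 2 * A - Y" by simp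
      have "(c1 + 2 * c2) * (A - Y) = 0" using that(1) unfolding X by (simp add: algebra_simps)
      then show False using that(2) c122 by simp
    qed
    ultimately show ?thesis using that(2) by auto
  qed
  have pigeonhole: False if "distinct [A, X, Y, B]" "{A, X, Y, B} \<subseteq> S" "finite S" "card S \<le> 3"
    for A X Y B :: int and S
    using distinct_card[OF that(1)] card_mono[OF that(3,2)] that(4) by simp
  have tot_rel: "c1 * (total a - total y) + c2 * (total x - total y) = 0"
  proof -
    have "c1 * (total a - total y) + c2 * (total x - total y) =
      (\<Sum>r<d. c1 * (Poly_Mapping.lookup a r - Poly_Mapping.lookup y r) +
        c2 * (Poly_Mapping.lookup x r - Poly_Mapping.lookup y r))"
      by (simp add: total_def sum.distrib sum_subtractf sum_distrib_left[symmetric])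
    then show ?thesis by (simp add: rel)
  qed
  have tot_b: "total b = total x + total y - total a" using arg_cong[OF par, of total] by (simp add: total_simps)
  have range: "total z \<in> {0, 1, 2}" if "z \<in> V" for z
    using that by (rule root_total[of z 0]) auto
  have eq: "total a = total y"
  proof (rule ccontr)
    assume "total a \<noteq> total y"
    show False
      by (rule pigeonhole[OF distinct[OF tot_rel \<open>total a \<noteq> total y\<close>], of "{0, 1, 2}"])
        (use range[OF V(1)] range[OF V(2)] range[OF V(3)] range[OF V(4)] tot_b in simp_all)
  qed
  then have "total x = total y" using tot_rel c2 by simp
  then have tot: "total x = total a" "total y = total a" "total b = total a" using eq tot_b by auto
  obtain r where r: "Poly_Mapping.lookup a r \<noteq> Poly_Mapping.lookup y r"
    using ne(3) by (meson poly_mapping_eqI)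
  \<comment> \<open>\<open>v\<close> is the least possible entry: -1 for roots with coordinate sum
    0, and 0 for the others.\<close>
  obtain v where v: "\<And>z. z \<in> V \<Longrightarrow> total z = total a \<Longrightarrow> Poly_Mapping.lookup z r \<in> {v, v + 1, v + 2}"
  proof (cases "total a = 0")
    case True
    show ?thesis by (rule that[of "- 1"]) (erule root_total[where r = r], use True in auto)
  next
    case False
    show ?thesis by (rule that[of 0]) (erule root_total[where r = r], use False in auto)
  qed
  show False
    by (rule pigeonhole[OF distinct[OF rel r], of "{v, v + 1, v + 2}"])
      (use v[OF V(1) refl] v[OF V(2) tot(3)] v[OF V(3) tot(1)] v[OF V(4) tot(2)] b[of r]
        in \<open>simp_all add: card_insert_if\<close>)
qed

end

section \<open>From roots to the columns of the matrix\<close>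

lemma sum_mset_as_sum:
  fixes f :: "'a \<Rightarrow> int"
  assumes "finite S" "set_mset M \<subseteq> S"
  shows "(\<Sum>t\<in>#M. f t) = (\<Sum>t\<in>S. int (count M t) * f t)"
  using assms(2)
proof (induction M)
  case (add x M)
  have "(\<Sum>t\<in>S. int (count (add_mset x M) t) * f t) =
      (\<Sum>t\<in>S. (if t = x then f t else 0) + int (count M t) * f t)"
    by (rule sum.cong) (auto simp: algebra_simps)
  also have "\<dots> = f x + (\<Sum>t\<in>S. int (count M t) * f t)"
    using add.prems assms(1) by (simp add: sum.distrib)
  finally show ?case using add by simp
qed simp

text \<open>\<open>\<alpha> j\<close> is the \<open>j\<close>-th column without its last entry. Root
  coordinates stop at \<open>d - 1\<close>, so the index \<open>d\<close> is free for the row of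
  ones.\<close>

locale root_matrix = root_config +
  fixes A :: "int mat" and \<alpha> :: "nat \<Rightarrow> nat \<Rightarrow>\<^sub>0 int"
  assumes inj_\<alpha>: "inj_on \<alpha> {..<dim_col A}"
    and image_\<alpha>: "\<alpha> ` {..<dim_col A} = V"
    and column: "\<And>j. j < dim_col A \<Longrightarrow>
      (\<Sum>i<dim_row A. Poly_Mapping.single i (A $$ (i, j))) = \<alpha> j + e d"
begin

abbreviation "n \<equiv> dim_col A"

lemma \<alpha>_root: "j < n \<Longrightarrow> \<alpha> j \<in> V"
  using image_\<alpha> by auto

lemma \<alpha>_eq_iff: "i < n \<Longrightarrow> j < n \<Longrightarrow> \<alpha> i = \<alpha> j \<longleftrightarrow> i = j"
  using inj_\<alpha> by (auto simp: inj_on_def)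

lemma root_lookup_d: "x \<in> V \<Longrightarrow> Poly_Mapping.lookup x d = 0"
  by (erule root_cases) (auto simp: lookup_add lookup_minus lookup_e)

lemma col_sum_eq:
  assumes "set_mset M \<subseteq> {..<n}"
  shows "col_sum A M = (\<Sum>j\<in>#M. \<alpha> j) + Poly_Mapping.single d (int (size M))"
  using assms
proof (induction M)
  case empty
  show ?case by (simp add: col_sum_def)
next
  case (add j M)
  have "col_sum A (add_mset j M) = (\<alpha> j + e d) + col_sum A M"
    using add.prems column[of j] by (simp add: col_sum_def)
  also have "\<dots> = (\<Sum>j\<in>#add_mset j M. \<alpha> j) + (e d + Poly_Mapping.single d (int (size M)))"
    using add by (simp add: algebra_simps)
  also have "e d + Poly_Mapping.single d (int (size M)) = Poly_Mapping.single d (int (size (add_mset j M)))"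
    by (simp flip: single_add)
  finally show ?case .
qed

text \<open>Roots vanish at coordinate \<open>d\<close>, so this coordinate of a column sum is the
  size, and the root part can be compared separately.\<close>

lemma col_sum_eq_iff:
  assumes "set_mset M \<subseteq> {..<n}" "set_mset N \<subseteq> {..<n}"
  shows "col_sum A M = col_sum A N \<longleftrightarrow> size M = size N \<and> (\<Sum>j\<in>#M. \<alpha> j) = (\<Sum>j\<in>#N. \<alpha> j)"
proof
  assume eq: "col_sum A M = col_sum A N"
  have "Poly_Mapping.lookup (\<Sum>j\<in>#M. \<alpha> j) d = 0" if "set_mset M \<subseteq> {..<n}" for M
    using that by (induction M) (auto simp: lookup_add root_lookup_d \<alpha>_root)
  then have "Poly_Mapping.lookup (col_sum A M) d = int (size M)" if "set_mset M \<subseteq> {..<n}" for M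
    using that by (simp add: col_sum_eq lookup_add)
  then have "size M = size N" using eq assms by (metis of_nat_eq_iff)
  then show "size M = size N \<and> (\<Sum>j\<in>#M. \<alpha> j) = (\<Sum>j\<in>#N. \<alpha> j)"
    using eq assms by (simp add: col_sum_eq)
qed (simp add: col_sum_eq assms)

lemma two_points:
  assumes "i < n" "j < n" "i \<noteq> j" "c + c' = 0"
    and "\<And>r. c * Poly_Mapping.lookup (\<alpha> i) r + c' * Poly_Mapping.lookup (\<alpha> j) r = 0"
  shows "c = 0 \<and> c' = 0"
proof -
  have c': "c' = - c" using assms(4) by simp
  then have "c * (Poly_Mapping.lookup (\<alpha> i) r - Poly_Mapping.lookup (\<alpha> j) r) = 0" for r
    using assms(5)[of r] by (simp add: algebra_simps)
  moreover have "\<alpha> i \<noteq> \<alpha> j" using assms(1-3) by (simp add: \<alpha>_eq_iff)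
  then obtain r where "Poly_Mapping.lookup (\<alpha> i) r \<noteq> Poly_Mapping.lookup (\<alpha> j) r"
    by (meson poly_mapping_eqI)
  ultimately show ?thesis using c' by (metis mult_eq_0_iff neg_equal_0_iff_equal right_minus_eq)
qed

text \<open>A common index could be cancelled, and injectivity of \<open>\<alpha>\<close> would make
  the pairs equal. Two squares are impossible because \<open>2 x = 2 y\<close> implies
  \<open>x = y\<close> for integer vectors.\<close>

lemma quadric_relation:
  assumes lt: "i < n" "j < n" "k < n" "l < n"
    and par: "\<alpha> i + \<alpha> j = \<alpha> k + \<alpha> l" and ne: "{#i, j#} \<noteq> {#k, l#}"
  shows "{i, j} \<inter> {k, l} = {}" "i \<noteq> j \<or> k \<noteq> l"
proof -
  show "i \<noteq> j \<or> k \<noteq> l"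
  proof (rule ccontr)
    assume "\<not> ?thesis"
    then have eq: "i = j" "k = l" by auto
    have "\<alpha> i + \<alpha> i = \<alpha> k + \<alpha> k" using par by (simp only: eq)
    then have "Poly_Mapping.lookup (\<alpha> i) r + Poly_Mapping.lookup (\<alpha> i) r =
        Poly_Mapping.lookup (\<alpha> k) r + Poly_Mapping.lookup (\<alpha> k) r" for r
      by (metis lookup_add)
    then have "Poly_Mapping.lookup (\<alpha> i) r = Poly_Mapping.lookup (\<alpha> k) r" for r
      by (smt (verit))
    then have "\<alpha> i = \<alpha> k" by (intro poly_mapping_eqI) simp
    then show False using ne lt eq by (simp add: \<alpha>_eq_iff)
  qed
  have "x = y" if "x < n" "y < n" "z < n" "\<alpha> z + \<alpha> x = \<alpha> z + \<alpha> y" for x y z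
    using that by (simp add: \<alpha>_eq_iff)
  then show "{i, j} \<inter> {k, l} = {}"
    using ne lt par by (auto simp: add.commute add_mset_commute)
qed

text \<open>\<open>c\<close> stands for the exponent difference of a binomial that avoids the
  variable \<open>j\<close>. The other points are two or three in number and affinely independent,
  so they carry no dependency.\<close>

lemma quadric_no_smaller:
  assumes lt: "i < n" "j < n" "k < n" "l < n"
    and par: "\<alpha> i + \<alpha> j = \<alpha> k + \<alpha> l" and ne: "{#i, j#} \<noteq> {#k, l#}"
    and c: "(\<Sum>t\<in>{i, j, k, l}. c t) = 0"
      "\<And>r. (\<Sum>t\<in>{i, j, k, l}. c t * Poly_Mapping.lookup (\<alpha> t) r) = 0"
    and cj: "c j = 0"
  shows "\<forall>t\<in>{i, j, k, l}. c t = 0"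
proof -
  note rel = quadric_relation[OF lt par ne]
  consider "i = j" "k \<noteq> l" | "i \<noteq> j" "k = l" | "i \<noteq> j" "k \<noteq> l" using rel(2) by blast
  then show ?thesis
  proof cases
    case 1
    have "c k = 0 \<and> c l = 0"
      by (rule two_points[of k l]) (use 1 lt c rel cj in \<open>auto simp: insert_commute\<close>)
    then show ?thesis using 1 cj by simp
  next
    case 2
    have "c i = 0 \<and> c k = 0"
      by (rule two_points[of i k]) (use 2 lt c rel cj in \<open>auto simp: insert_commute\<close>)
    then show ?thesis using 2 cj by simp
  next
    case 3
    have "c i = 0 \<and> c k = 0 \<and> c l = 0"
      by (rule roots_affinely_independent[of "\<alpha> i" "\<alpha> j" "\<alpha> k" "\<alpha> l"])
        (use 3 lt c rel cj par in \<open>auto simp: \<alpha>_root \<alpha>_eq_iff add.assoc\<close>)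
    then show ?thesis using cj by simp
  qed
qed

text \<open>A smaller support omits one of the four variables. The relation is symmetric under
  exchanging the sides and the members of each side, so every case reduces to an omitted
  \<open>j\<close>.\<close>

lemma quadric_minimal:
  fixes g :: "'k::field mpoly"
  assumes lt: "i < n" "j < n" "k < n" "l < n"
    and par: "\<alpha> i + \<alpha> j = \<alpha> k + \<alpha> l" and ne: "{#i, j#} \<noteq> {#k, l#}"
    and g: "g \<in> toric_ideal A" "is_binomial g" "supp g \<subset> {i, j, k, l}"
  shows False
proof -
  obtain P Q where PQ: "P \<noteq> Q" "g = monomial (expo P) - monomial (expo Q)"
    using g(2) unfolding is_binomial_def by (metis expo_cases)
  let ?S = "{i, j, k, l}"
  have supp: "supp g = set_mset P \<union> set_mset Q"
    using PQ by (simp add: supp_binomial expo_inject keys_expo)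
  have sub: "set_mset P \<subseteq> {..<n}" "set_mset Q \<subseteq> {..<n}" and eq: "col_sum A P = col_sum A Q"
    using g(1) PQ binomial_mem_toric_ideal[OF PQ(1), of A] by auto
  have sum: "size P = size Q" "(\<Sum>j\<in>#P. \<alpha> j) = (\<Sum>j\<in>#Q. \<alpha> j)"
    using eq col_sum_eq_iff[OF sub] by auto
  define c where "c t = int (count P t) - int (count Q t)" for t
  have PS: "set_mset P \<subseteq> ?S" and QS: "set_mset Q \<subseteq> ?S" using g(3) supp by auto
  have lin: "(\<Sum>t\<in>?S. c t * f t) = (\<Sum>t\<in>#P. f t) - (\<Sum>t\<in>#Q. f t)" for f
    by (simp only: c_def left_diff_distrib sum_subtractf sum_mset_as_sum[of ?S, OF _ PS]
        sum_mset_as_sum[of ?S, OF _ QS] finite.intros)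
  have c1: "(\<Sum>t\<in>?S. c t) = 0" using lin[of "\<lambda>_. 1"] sum(1) by simp
  have c2: "(\<Sum>t\<in>?S. c t * Poly_Mapping.lookup (\<alpha> t) r) = 0" for r
    using lin[of "\<lambda>t. Poly_Mapping.lookup (\<alpha> t) r"] arg_cong[OF sum(2), of "\<lambda>z. Poly_Mapping.lookup z r"]
    by (simp add: lookup_sum_mset image_mset.compositionality comp_def)
  obtain m where m: "m \<in> ?S" "m \<notin> supp g" using g(3) by blast
  then have cm: "c m = 0" by (simp add: c_def supp not_in_iff)
  have perm: "{j, i, k, l} = ?S" "{k, l, i, j} = ?S" "{l, k, i, j} = ?S" by auto
  have "\<forall>t\<in>?S. c t = 0"
  proof -
    consider "m = j" | "m = i" | "m = l" | "m = k" using m(1) by blast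
    then show ?thesis
    proof cases
      case 1
      then show ?thesis using quadric_no_smaller[OF lt par ne c1 c2] cm by blast
    next
      case 2
      have "\<alpha> j + \<alpha> i = \<alpha> k + \<alpha> l" "{#j, i#} \<noteq> {#k, l#}"
        using par ne by (simp_all add: add.commute add_mset_commute)
      from quadric_no_smaller[OF lt(2,1,3,4) this, of c] show ?thesis
        using c1 c2 cm 2 unfolding perm by blast
    next
      case 3
      from quadric_no_smaller[OF lt(3,4,1,2) par[symmetric] ne[symmetric], of c] show ?thesis
        using c1 c2 cm 3 unfolding perm by blast
    next
      case 4
      have "\<alpha> l + \<alpha> k = \<alpha> i + \<alpha> j" "{#l, k#} \<noteq> {#i, j#}"
        using par ne by (simp_all add: add.commute add_mset_commute)
      from quadric_no_smaller[OF lt(4,3,1,2) this, of c] show ?thesis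
        using c1 c2 cm 4 unfolding perm by blast
    qed
  qed
  moreover have "c t = 0" if "t \<notin> ?S" for t
  proof -
    have "t \<notin># P" "t \<notin># Q" using that PS QS by auto
    then show ?thesis by (simp add: c_def not_in_iff)
  qed
  ultimately have "\<And>t. c t = 0" by blast
  then have "P = Q" by (intro multiset_eqI) (simp add: c_def)
  then show False using PQ(1) by blast
qed

lemma quadric_circuit:
  assumes lt: "i < n" "j < n" "k < n" "l < n"
    and par: "\<alpha> i + \<alpha> j = \<alpha> k + \<alpha> l" and ne: "{#i, j#} \<noteq> {#k, l#}"
  shows "(monomial (expo {#i, j#}) - monomial (expo {#k, l#}) :: 'k::field mpoly) \<in>
    {f \<in> circuits_sf A. is_quadratic_binomial f}"
proof -
  let ?f = "monomial (expo {#i, j#}) - monomial (expo {#k, l#}) :: 'k mpoly"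
  note rel = quadric_relation[OF lt par ne]
  have ne': "expo {#i, j#} \<noteq> expo {#k, l#}" using ne by (simp add: expo_inject)
  have "?f \<in> toric_ideal A"
    using lt par col_sum_eq_iff[of "{#i, j#}" "{#k, l#}"] by (simp add: binomial_mem_toric_ideal[OF ne])
  moreover have "is_binomial ?f" using ne' unfolding is_binomial_def by blast
  moreover have "ring_irreducible\<^bsub>mpoly_ring n\<^esub> ?f"
    using quadratic_binomial_irreducible[OF lt rel, where 'k = 'k]
    by (simp only: expo_simps add_0_right)
  moreover have "supp ?f = {i, j, k, l}" using supp_binomial[OF ne'] by (simp add: keys_expo insert_commute)
  then have "\<not> (\<exists>g :: 'k mpoly. g \<in> toric_ideal A \<and> is_binomial g \<and> supp g \<subset> supp ?f)"
    using quadric_minimal[OF lt par ne] by metis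
  ultimately have "?f \<in> circuits A" unfolding circuits_def by blast
  \<comment> \<open>At most one of the two monomials is the square of a variable.\<close>
  moreover have "squarefree_mon (expo {#i, j#}) \<or> squarefree_mon (expo {#k, l#})"
    using rel(2) by (auto simp: squarefree_mon_def lookup_expo)
  ultimately have "?f \<in> circuits_sf A" unfolding circuits_sf_def using ne' by blast
  moreover have "is_quadratic_binomial ?f"
    unfolding is_quadratic_binomial_def using ne' by (intro exI conjI) (auto simp: mon_degree_expo)
  ultimately show ?thesis by blast
qed

text \<open>Along a path of moves the differences of monomials telescope, and each move contributes
  a quadric times the monomial of the untouched elements.\<close>

theorem toric_ideal_generated:
  "(toric_ideal A :: 'k::field mpoly set) =
    Idl\<^bsub>mpoly_ring n\<^esub> {f \<in> circuits_sf A. is_quadratic_binomial f}" (is "_ = Idl\<^bsub>_\<^esub> ?S")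
proof
  interpret cring "mpoly_ring n :: 'k mpoly ring" by (rule cring_mpoly_ring)
  have S: "?S \<subseteq> toric_ideal A" by (auto simp: circuits_sf_def circuits_def)
  show "Idl\<^bsub>mpoly_ring n\<^esub> ?S \<subseteq> toric_ideal A" by (rule genideal_minimal[OF ideal_toric_ideal S])
  have Sc: "?S \<subseteq> carrier (mpoly_ring n)" using S by (auto simp: mem_toric_ideal)
  let ?J = "Idl\<^bsub>mpoly_ring n\<^esub> ?S"
  have J: "ideal ?J (mpoly_ring n)" by (rule genideal_ideal[OF Sc])
  define ix where "ix = the_inv_into {..<n} \<alpha>"
  have ix: "ix x < n" "\<alpha> (ix x) = x" if "x \<in> V" for x
    using the_inv_into_into[OF inj_\<alpha>, of x "{..<n}"] f_the_inv_into_f[OF inj_\<alpha>, of x] that image_\<alpha>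
    by (auto simp: ix_def)
  let ?m = "\<lambda>P. monomial (expo (image_mset ix P)) :: 'k mpoly"
  have quadric: "?m {#a, b#} - ?m {#x, y#} \<in> ?J"
    if "a \<in> V" "b \<in> V" "x \<in> V" "y \<in> V" "a + b = x + y" for a b x y
  proof (cases "{#ix a, ix b#} = {#ix x, ix y#}")
    \<comment> \<open>A move may replace a pair by itself; its difference is 0 and not a
      binomial.\<close>
    case True
    then show ?thesis using ideal_mpoly_ring_closed(1)[OF J] by simp
  next
    case False
    have "?m {#a, b#} - ?m {#x, y#} \<in> ?S"
      using quadric_circuit[OF ix(1)[OF that(1)] ix(1)[OF that(2)] ix(1)[OF that(3)] ix(1)[OF that(4)] _ False,
          where 'k = 'k] that ix(2) by simp
    then show ?thesis using genideal_self[OF Sc] by blast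
  qed
  have diff: "?m P - ?m Q \<in> ?J" if "conn V P Q" "set_mset P \<subseteq> V" for P Q
    using that
  proof (induction rule: rtranclp_induct)
    case base
    show ?case using ideal_mpoly_ring_closed(1)[OF J] by simp
  next
    case (step Q Q')
    have QV: "set_mset Q \<subseteq> V" using conn_subset[OF step(1)] step(4) by blast
    from step(2) obtain a b x y X where q: "a \<in> V" "b \<in> V" "x \<in> V" "y \<in> V" "a + b = x + y"
      "Q = {#a, b#} + X" "Q' = {#x, y#} + X" unfolding quadratic_move_def by blast
    have "?m Q - ?m Q' = (?m {#a, b#} - ?m {#x, y#}) * ?m X"
      by (simp add: q(6,7) expo_simps left_diff_distrib mult_single add.assoc)
    moreover have "?m X \<in> carrier (mpoly_ring n)"
      using QV q(6) ix(1) by (auto simp: mpoly_ring_def keys_expo)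
    ultimately have "?m Q - ?m Q' \<in> ?J"
      using ideal_mpoly_ring_closed(3)[OF J quadric[OF q(1-5)]] by simp
    then have "(?m P - ?m Q) + (?m Q - ?m Q') \<in> ?J"
      using ideal_mpoly_ring_closed(2)[OF J] step by blast
    then show ?case by simp
  qed
  show "toric_ideal A \<subseteq> ?J"
  proof (rule toric_ideal_subset[OF J])
    fix M N assume MN: "set_mset M \<subseteq> {..<n}" "set_mset N \<subseteq> {..<n}" "col_sum A M = col_sum A N"
    have im: "image_mset ix (image_mset \<alpha> M) = M" if "set_mset M \<subseteq> {..<n}" for M
    proof -
      have "image_mset (ix \<circ> \<alpha>) M = image_mset id M"
        using that inj_\<alpha> by (intro image_mset_cong) (auto simp: ix_def the_inv_into_f_f subset_iff)
      then show ?thesis by (simp add: image_mset.compositionality)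
    qed
    have "same_fiber V (image_mset \<alpha> M) (image_mset \<alpha> N)"
      using MN col_sum_eq_iff[OF MN(1,2)] \<alpha>_root by (auto simp: same_fiber_def)
    then have "?m (image_mset \<alpha> M) - ?m (image_mset \<alpha> N) \<in> ?J"
      by (intro diff roots_conn) (auto simp: same_fiber_def)
    then show "monomial (expo M) - monomial (expo N) \<in> ?J" by (simp only: im MN)
  qed
qed

end

section \<open>The four matrices\<close>

text \<open>Transports vectors of dimension \<open>d\<close> into an additive group, where sums over
  multisets carry no dimension conditions.\<close>

definition vec_pm :: "nat \<Rightarrow> int vec \<Rightarrow> (nat \<Rightarrow>\<^sub>0 int)" where
  "vec_pm d v = (\<Sum>i<d. Poly_Mapping.single i (v $ i))"

lemma lookup_vec_pm: "Poly_Mapping.lookup (vec_pm d v) r = (if r < d then v $ r else 0)"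
  by (simp add: vec_pm_def lookup_sum lookup_single when_def)

lemma vec_pm_simps:
  "vec_pm d (0\<^sub>v d) = 0"
  "i < d \<Longrightarrow> vec_pm d (unit_vec d i) = e i"
  "v \<in> carrier_vec d \<Longrightarrow> w \<in> carrier_vec d \<Longrightarrow> vec_pm d (v + w) = vec_pm d v + vec_pm d w"
  "v \<in> carrier_vec d \<Longrightarrow> w \<in> carrier_vec d \<Longrightarrow> vec_pm d (v - w) = vec_pm d v - vec_pm d w"
  by (rule poly_mapping_eqI; auto simp: lookup_vec_pm lookup_add lookup_minus lookup_e)+

text \<open>The order of the columns is arbitrary, so the numbering of the roots is read off from
  the matrix; distinctness of the columns makes it injective, because they all end in 1.\<close>

lemma toric_ideal_tilde:
  assumes tilde: "is_tilde d \<Phi> A" and \<Phi>: "\<Phi> \<subseteq> carrier_vec d"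
    and img: "vec_pm d ` \<Phi> = roots pairs singles doubles d"
    and conf: "root_config pairs singles doubles"
  shows "(toric_ideal A :: 'k::field mpoly set) =
    Idl\<^bsub>mpoly_ring (dim_col A)\<^esub> {f \<in> circuits_sf A. is_quadratic_binomial f}"
proof -
  have dim: "dim_row A = d + 1" and dist: "distinct (cols A)"
    and cols: "set (cols A) = (\<lambda>\<beta>. \<beta> @\<^sub>v vec 1 (\<lambda>_. 1)) ` \<Phi>"
    using tilde by (auto simp: is_tilde_def)
  define \<alpha> where "\<alpha> j = (\<Sum>i<d. Poly_Mapping.single i (A $$ (i, j)))" for j
  have lk: "Poly_Mapping.lookup (\<alpha> j) r = (if r < d then A $$ (r, j) else 0)" for j r
    by (simp add: \<alpha>_def lookup_sum lookup_single when_def)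
  have col: "\<exists>\<beta>\<in>\<Phi>. col A j = \<beta> @\<^sub>v vec 1 (\<lambda>_. 1)" if "j < dim_col A" for j
  proof -
    have "col A j \<in> set (cols A)" using that by (simp add: cols_def)
    then show ?thesis using cols by auto
  qed
  have entry: "A $$ (i, j) = (if i < d then \<beta> $ i else 1)"
    if "j < dim_col A" "col A j = \<beta> @\<^sub>v vec 1 (\<lambda>_. 1)" "\<beta> \<in> \<Phi>" "i < d + 1" for i j \<beta>
  proof -
    have "dim_vec \<beta> = d" using that(3) \<Phi> by auto
    moreover have "A $$ (i, j) = col A j $ i" using that(1,4) dim by simp
    ultimately show ?thesis using that(2,4) by simp
  qed
  have \<alpha>: "\<alpha> j = vec_pm d \<beta>"
    if "j < dim_col A" "col A j = \<beta> @\<^sub>v vec 1 (\<lambda>_. 1)" "\<beta> \<in> \<Phi>" for j \<beta>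
    using entry[OF that] by (intro poly_mapping_eqI) (simp add: lk lookup_vec_pm)
  interpret root_config d pairs singles doubles by (rule conf)
  interpret root_matrix d pairs singles doubles A \<alpha>
  proof
    show "inj_on \<alpha> {..<dim_col A}"
    proof (rule inj_onI)
      fix i j assume ij: "i \<in> {..<dim_col A}" "j \<in> {..<dim_col A}" "\<alpha> i = \<alpha> j"
      have "A $$ (r, i) = A $$ (r, j)" if "r < d + 1" for r
      proof (cases "r < d")
        case True
        then show ?thesis using arg_cong[OF ij(3), of "\<lambda>z. Poly_Mapping.lookup z r"] by (simp add: lk)
      next
        case False
        then show ?thesis using col[of i] col[of j] ij(1,2) entry that by (metis lessThan_iff)
      qed
      then have "col A i = col A j" using ij(1,2) dim by (intro eq_vecI) auto
      then have "cols A ! i = cols A ! j" using ij(1,2) by simp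
      then show "i = j" using nth_eq_iff_index_eq[OF dist, of i j] ij(1,2) by simp
    qed
    show "\<alpha> ` {..<dim_col A} = V"
    proof
      show "\<alpha> ` {..<dim_col A} \<subseteq> V" using col \<alpha> img by fastforce
      show "V \<subseteq> \<alpha> ` {..<dim_col A}"
      proof
        fix x assume "x \<in> V"
        then obtain \<beta> where b: "\<beta> \<in> \<Phi>" "x = vec_pm d \<beta>" using img by blast
        then have "\<beta> @\<^sub>v vec 1 (\<lambda>_. 1) \<in> set (cols A)" using cols by blast
        then obtain j where "j < dim_col A" "col A j = \<beta> @\<^sub>v vec 1 (\<lambda>_. 1)"
          by (metis cols_length cols_nth in_set_conv_nth)
        then have "x = \<alpha> j" "j \<in> {..<dim_col A}" using \<alpha>[of j \<beta>] b by simp_all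
        then show "x \<in> \<alpha> ` {..<dim_col A}" by (rule image_eqI)
      qed
    qed
    show "(\<Sum>i<dim_row A. Poly_Mapping.single i (A $$ (i, j))) = \<alpha> j + e d" if "j < dim_col A" for j
    proof -
      have "A $$ (d, j) = 1" using col[OF that] entry[OF that] by force
      then show ?thesis by (simp add: dim \<alpha>_def)
    qed
  qed
  show ?thesis by (rule toric_ideal_generated)
qed

lemma image_Collect2:
  assumes "\<And>i j. P i j \<Longrightarrow> f (g i j) = h i j"
  shows "f ` {g i j | i j. P i j} = {h i j | i j. P i j}"
proof (intro equalityI subsetI)
  fix x assume "x \<in> {h i j | i j. P i j}"
  then obtain i j where "x = h i j" "P i j" by blast
  then show "x \<in> f ` {g i j | i j. P i j}" using assms by (intro image_eqI[of _ _ "g i j"]) auto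
qed (use assms in blast)

lemma vec_pm_pos_A: "vec_pm d ` pos_A d = roots False False False d"
  "pos_A d \<subseteq> carrier_vec d"
proof -
  show "pos_A d \<subseteq> carrier_vec d" by (auto simp: pos_A_def)
  have "vec_pm d ` {unit_vec d i - unit_vec d j | i j. i < j \<and> j < d} = {e i - e j | i j. i < j \<and> j < d}"
    by (rule image_Collect2) (simp add: vec_pm_simps)
  then show "vec_pm d ` pos_A d = roots False False False d"
    by (simp add: pos_A_def roots_def vec_pm_simps image_Un)
qed

text \<open>The computation for type A is thereby reused as the common base of the other three
  types.\<close>

lemma roots_split: "roots p s t d = roots False False False d
    \<union> {e i + e j | i j. p \<and> i < j \<and> j < d} \<union> {e i | i. s \<and> i < d} \<union> {e i + e i | i. t \<and> i < d}"
  by (simp add: roots_def)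

lemma vec_pm_sums:
  "vec_pm d ` {unit_vec d i + unit_vec d j | i j. i < j \<and> j < d} = {e i + e j | i j. i < j \<and> j < d}"
  "vec_pm d ` {unit_vec d i | i. i < d} = {e i | i. i < d}"
  "vec_pm d ` {unit_vec d i + unit_vec d j | i j. i \<le> j \<and> j < d} =
    {e i + e j | i j. i < j \<and> j < d} \<union> {e i + e i | i. i < d}"
proof -
  show "vec_pm d ` {unit_vec d i + unit_vec d j | i j. i < j \<and> j < d} = {e i + e j | i j. i < j \<and> j < d}"
    by (rule image_Collect2) (simp add: vec_pm_simps)
  show "vec_pm d ` {unit_vec d i | i. i < d} = {e i | i. i < d}"
    using image_Collect2[of "\<lambda>i _. i < d" "vec_pm d" "\<lambda>i _. unit_vec d i" "\<lambda>i _. e i"]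
    by (simp add: vec_pm_simps)
  have "vec_pm d ` {unit_vec d i + unit_vec d j | i j. i \<le> j \<and> j < d} = {e i + e j | i j. i \<le> j \<and> j < d}"
    by (rule image_Collect2) (simp add: vec_pm_simps)
  also have "\<dots> = {e i + e j | i j. i < j \<and> j < d} \<union> {e i + e i | i. i < d}"
    unfolding le_less by blast
  finally show "vec_pm d ` {unit_vec d i + unit_vec d j | i j. i \<le> j \<and> j < d} =
    {e i + e j | i j. i < j \<and> j < d} \<union> {e i + e i | i. i < d}" .
qed

lemma vec_pm_pos_B: "vec_pm d ` pos_B d = roots True True False d" "pos_B d \<subseteq> carrier_vec d"
  using vec_pm_pos_A[of d] unfolding pos_B_def roots_split[of True]
  by (simp_all only: image_Un vec_pm_sums) auto

lemma vec_pm_pos_C: "vec_pm d ` pos_C d = roots True False True d" "pos_C d \<subseteq> carrier_vec d"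
  using vec_pm_pos_A[of d] unfolding pos_C_def roots_split[of True]
  by (simp_all only: image_Un vec_pm_sums) auto

lemma vec_pm_pos_D: "vec_pm d ` pos_D d = roots True False False d" "pos_D d \<subseteq> carrier_vec d"
  using vec_pm_pos_A[of d] unfolding pos_D_def roots_split[of True]
  by (simp_all only: image_Un vec_pm_sums) auto

theorem corollary1p5:
  fixes d :: nat and A :: "int mat"
  assumes "d \<ge> 2"
    and "is_tilde d (pos_A d) A \<or> is_tilde d (pos_B d) A \<or>
         is_tilde d (pos_C d) A \<or> is_tilde d (pos_D d) A"
  shows "(toric_ideal A :: 'k::field mpoly set) =
    Idl\<^bsub>mpoly_ring (dim_col A)\<^esub> {f \<in> circuits_sf A. is_quadratic_binomial f}"
  using assms(2)
proof (elim disjE)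
  assume "is_tilde d (pos_A d) A"
  then show ?thesis by (rule toric_ideal_tilde[OF _ vec_pm_pos_A(2,1)]) (simp add: root_config_def)
next
  assume "is_tilde d (pos_B d) A"
  then show ?thesis by (rule toric_ideal_tilde[OF _ vec_pm_pos_B(2,1)]) (simp add: root_config_def)
next
  assume "is_tilde d (pos_C d) A"
  then show ?thesis by (rule toric_ideal_tilde[OF _ vec_pm_pos_C(2,1)]) (simp add: root_config_def)
next
  assume "is_tilde d (pos_D d) A"
  then show ?thesis by (rule toric_ideal_tilde[OF _ vec_pm_pos_D(2,1)]) (simp add: root_config_def)
qed

end
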